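(* Assume $q^{2d}\neq1$ for all integers $d\ge1$. Let $I=\{1,\dots,p\}$ and let $f\in H_I$ be an invariant element which is homogeneous of degree $n_i$ in $x_i,y_i$ for each $i\in I$. Then $$f=\sum_{k=0}^{n_1}\frac{\begin{bmatrix} n_1\\ k\end{bmatrix}\begin{bmatrix} n_2\\ k\end{bmatrix}}{\begin{bmatrix} n_1+n_2-k+1\\ k\end{bmatrix}}\,(12)^k\,P_{21}^{\,n_1-k}P_{12}^{\,n_1-k}\,\Omega_{12}^{\,k}f,$$ where the terms with $k>n_2$ (whose coefficient vanishes) are taken to be $0$.
   Context: Fix $q\in\mathbb C$ with $|q|=1$, $q\neq\pm1,\pm i$, and a square root $q^{1/2}$. $[m]=\frac{q^m-q^{-m}}{q-q^{-1}}$, $(m)=\frac{q^{2m}-1}{q^2-1}$, $[m]!=[1]\cdots[m]$, $\begin{bmatrix} n\\ k\end{bmatrix}=\frac{[n]!}{[n-k]![k]!}$. For $I=\{1,\dots,p\}$, $H_I$ is the unital associative $\mathbb C$-algebra generated by $x_i,y_i$ with relations $x_iy_i=qy_ix_i$ and, for $i<j$: $x_jx_i=q^2x_ix_j$, $y_jy_i=q^2y_iy_j$, $x_jy_i=qy_ix_j+(q^2-1)x_iy_j$, $y_jx_i=qx_iy_j$; PBW basis: ordered monomials $x_{a_1}^{i_1}y_{a_1}^{j_1}\cdots x_{a_r}^{i_r}y_{a_r}^{j_r}$, $a_1<\dots<a_r$. $U_q(gl(2,\mathbb R))$, generated by $E,F,K^{\pm1},L^{\pm1}$, acts on $H_I$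 by $L1=K1=1$, $E1=F1=0$, $Lx_i=q^{1/2}x_i$, $Ly_i=q^{1/2}y_i$, $Kx_i=q^{-1/2}x_i$, $Ky_i=q^{1/2}y_i$, $Ex_i=q^{1/2}y_i$, $Ey_i=0$, $Fx_i=0$, $Fy_i=q^{-1/2}x_i$, extended by $K(ab)=K(a)K(b)$, $L(ab)=L(a)L(b)$, $E(ab)=E(a)K(b)+K^{-1}(a)E(b)$, $F(ab)=F(a)K(b)+K^{-1}(a)F(b)$; $a$ is an invariant element (of degree $k$) if $Ea=Fa=0$, $Ka=a$, $La=q^{k/2}a$. $(ij):=q^{-1/2}x_iy_j-q^{1/2}y_ix_j$. For $k\neq l$, $\Delta_{kl}$ is the linear map defined on each PBW monomial, viewed as a word $z_1\cdots z_N$ in the generators, by $\Delta_{kl}(z_1\cdots z_N)=\sum_{r:\,z_r\in\{x_k,y_k\}}z_1\cdots z_{r-1}z_r'z_{r+1}\cdots z_N$ (product in $H_I$), $x_k'=x_l$, $y_k'=y_l$; $P_{kl}(a)=\frac1{(n_k)}\Delta_{kl}(a)$ for a PBW monomial $a$ of degree $n_k\ge1$ in $x_k,y_k$, extended linearly. Quantum $\Omega$-process: if $g$ is a linear combination of PBW monomials each of degree $m\ge1$ in $x_1,y_1$ and $n\ge1$ in $x_2,y_2$, there is a unique $a\in H_I$ with $g=P_{21}P_{12}g+(12)a$, and $\Omega_{12}(g):=\frac{[n+1]}{[n]}a$. *)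

theory Defs
  imports Complex_Main
begin

datatype gen = X nat | Y nat

fun gen_idx :: "gen \<Rightarrow> nat" where
  "gen_idx (X i) = i" | "gen_idx (Y i) = i"

text \<open>Elements of the free algebra: coefficient functions on words (finitely supported
  for genuine elements).\<close>
type_synonym fa = "gen list \<Rightarrow> complex"

definition fa_supp :: "fa \<Rightarrow> gen list set" where
  "fa_supp a = {w. a w \<noteq> 0}"

definition fa_zero :: fa where "fa_zero = (\<lambda>w. 0)"
definition fa_word :: "gen list \<Rightarrow> fa" where
  "fa_word u = (\<lambda>w. if w = u then 1 else 0)"
definition fa_add :: "fa \<Rightarrow> fa \<Rightarrow> fa" where "fa_add a b = (\<lambda>w. a w + b w)"
definition fa_minus :: "fa \<Rightarrow> fa \<Rightarrow> fa" where "fa_minus a b = (\<lambda>w. a w - b w)"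
definition fa_smult :: "complex \<Rightarrow> fa \<Rightarrow> fa" where "fa_smult c a = (\<lambda>w. c * a w)"
definition fa_mul :: "fa \<Rightarrow> fa \<Rightarrow> fa" where
  "fa_mul a b = (\<lambda>w. \<Sum>k\<le>length w. a (take k w) * b (drop k w))"
definition fa_sum :: "('i \<Rightarrow> fa) \<Rightarrow> 'i set \<Rightarrow> fa" where
  "fa_sum g A = (\<lambda>w. \<Sum>i\<in>A. g i w)"
definition fa_pow :: "fa \<Rightarrow> nat \<Rightarrow> fa" where
  "fa_pow a k = (fa_mul a ^^ k) (fa_word [])"

definition lin_ext :: "(gen list \<Rightarrow> fa) \<Rightarrow> fa \<Rightarrow> fa" where
  "lin_ext g h = fa_sum (\<lambda>w. fa_smult (h w) (g w)) (fa_supp h)"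

definition words_in :: "nat \<Rightarrow> gen list \<Rightarrow> bool" where
  "words_in p w \<longleftrightarrow> (\<forall>z\<in>set w. gen_idx z \<in> {1..p})"

definition valid :: "nat \<Rightarrow> fa \<Rightarrow> bool" where
  "valid p a \<longleftrightarrow> finite (fa_supp a) \<and> (\<forall>w\<in>fa_supp a. words_in p w)"

definition w2 :: "gen \<Rightarrow> gen \<Rightarrow> fa" where "w2 a b = fa_word [a, b]"

definition relations :: "complex \<Rightarrow> nat \<Rightarrow> fa set" where
  "relations q p =
     {fa_minus (w2 (X i) (Y i)) (fa_smult q (w2 (Y i) (X i))) | i. i \<in> {1..p}}
   \<union> {fa_minus (w2 (X j) (X i)) (fa_smult (q^2) (w2 (X i) (X j))) | i j. 1 \<le> i \<and> i < j \<and> j \<le> p}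
   \<union> {fa_minus (w2 (Y j) (Y i)) (fa_smult (q^2) (w2 (Y i) (Y j))) | i j. 1 \<le> i \<and> i < j \<and> j \<le> p}
   \<union> {fa_minus (w2 (X j) (Y i)) (fa_add (fa_smult q (w2 (Y i) (X j))) (fa_smult (q^2 - 1) (w2 (X i) (Y j))))
        | i j. 1 \<le> i \<and> i < j \<and> j \<le> p}
   \<union> {fa_minus (w2 (Y j) (X i)) (fa_smult q (w2 (X i) (Y j))) | i j. 1 \<le> i \<and> i < j \<and> j \<le> p}"

inductive in_ideal :: "complex \<Rightarrow> nat \<Rightarrow> fa \<Rightarrow> bool" for q p where
  zero: "in_ideal q p fa_zero"
| step: "in_ideal q p a \<Longrightarrow> r \<in> relations q p \<Longrightarrow> words_in p u \<Longrightarrow> words_in p v \<Longrightarrow>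
          in_ideal q p (fa_add a (fa_smult c (fa_mul (fa_word u) (fa_mul r (fa_word v)))))"

definition eqH :: "complex \<Rightarrow> nat \<Rightarrow> fa \<Rightarrow> fa \<Rightarrow> bool" where
  "eqH q p a b \<longleftrightarrow> in_ideal q p (fa_minus a b)"

text \<open>Exponent data e a = (i_a, j_a) of an ordered monomial
  x_1^{i_1} y_1^{j_1} ... x_p^{i_p} y_p^{j_p}.\<close>
definition pbw_exps :: "nat \<Rightarrow> (nat \<Rightarrow> nat \<times> nat) set" where
  "pbw_exps p = {e. \<forall>a. a \<notin> {1..p} \<longrightarrow> e a = (0, 0)}"

definition pbw_word :: "nat \<Rightarrow> (nat \<Rightarrow> nat \<times> nat) \<Rightarrow> gen list" where
  "pbw_word p e = concat (map (\<lambda>a. replicate (fst (e a)) (X a) @ replicate (snd (e a)) (Y a)) [1..<Suc p])"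

definition pbw_deg :: "(nat \<Rightarrow> nat \<times> nat) \<Rightarrow> nat \<Rightarrow> nat" where
  "pbw_deg e k = fst (e k) + snd (e k)"

definition pbw_coords :: "complex \<Rightarrow> nat \<Rightarrow> fa \<Rightarrow> ((nat \<Rightarrow> nat \<times> nat) \<Rightarrow> complex)" where
  "pbw_coords q p h = (THE c. (\<forall>e. c e \<noteq> 0 \<longrightarrow> e \<in> pbw_exps p) \<and> finite {e. c e \<noteq> 0} \<and>
      eqH q p h (fa_sum (\<lambda>e. fa_smult (c e) (fa_word (pbw_word p e))) {e. c e \<noteq> 0}))"

definition qint :: "complex \<Rightarrow> nat \<Rightarrow> complex" where
  "qint q m = (q ^ m - inverse (q ^ m)) / (q - inverse q)"
definition qround :: "complex \<Rightarrow> nat \<Rightarrow> complex" where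
  "qround q m = (q ^ (2 * m) - 1) / (q ^ 2 - 1)"
definition qfact :: "complex \<Rightarrow> nat \<Rightarrow> complex" where
  "qfact q m = (\<Prod>i=1..m. qint q i)"
definition qbinom :: "complex \<Rightarrow> nat \<Rightarrow> nat \<Rightarrow> complex" where
  "qbinom q n k = qfact q n / (qfact q (n - k) * qfact q k)"

section \<open>The U_q(gl(2)) action (s is the chosen square root q^(1/2))\<close>

fun Keig :: "complex \<Rightarrow> gen \<Rightarrow> complex" where
  "Keig s (X i) = inverse s" | "Keig s (Y i) = s"

definition Kw :: "complex \<Rightarrow> gen list \<Rightarrow> complex" where
  "Kw s w = prod_list (map (Keig s) w)"

definition actK :: "complex \<Rightarrow> fa \<Rightarrow> fa" where
  "actK s h = (\<lambda>w. Kw s w * h w)"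
definition actL :: "complex \<Rightarrow> fa \<Rightarrow> fa" where
  "actL s h = (\<lambda>w. s ^ length w * h w)"

text \<open>E(z_1...z_N) = sum_r K^{-1}(z_1..z_{r-1}) E(z_r) K(z_{r+1}..z_N), from the twisted
  Leibniz rule; E x_i = q^(1/2) y_i, E y_i = 0, F x_i = 0, F y_i = q^(-1/2) x_i.\<close>
definition E_word :: "complex \<Rightarrow> gen list \<Rightarrow> fa" where
  "E_word s w = fa_sum (\<lambda>r. case w ! r of
       X i \<Rightarrow> fa_smult (inverse (Kw s (take r w)) * s * Kw s (drop (Suc r) w))
                (fa_word (take r w @ Y i # drop (Suc r) w))
     | Y i \<Rightarrow> fa_zero) {..<length w}"
definition F_word :: "complex \<Rightarrow> gen list \<Rightarrow> fa" where
  "F_word s w = fa_sum (\<lambda>r. case w ! r of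
       Y i \<Rightarrow> fa_smult (inverse (Kw s (take r w)) * inverse s * Kw s (drop (Suc r) w))
                (fa_word (take r w @ X i # drop (Suc r) w))
     | X i \<Rightarrow> fa_zero) {..<length w}"

definition actE :: "complex \<Rightarrow> fa \<Rightarrow> fa" where "actE s = lin_ext (E_word s)"
definition actF :: "complex \<Rightarrow> fa \<Rightarrow> fa" where "actF s = lin_ext (F_word s)"

definition invariant :: "complex \<Rightarrow> complex \<Rightarrow> nat \<Rightarrow> fa \<Rightarrow> bool" where
  "invariant q s p a \<longleftrightarrow> (\<exists>k::nat. in_ideal q p (actE s a) \<and> in_ideal q p (actF s a) \<and>
      eqH q p (actK s a) a \<and> eqH q p (actL s a) (fa_smult (s ^ k) a))"

fun gprime :: "nat \<Rightarrow> gen \<Rightarrow> gen" where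
  "gprime l (X _) = X l" | "gprime l (Y _) = Y l"

definition delta_word :: "nat \<Rightarrow> nat \<Rightarrow> gen list \<Rightarrow> fa" where
  "delta_word k l w = fa_sum (\<lambda>r. fa_word (w[r := gprime l (w ! r)]))
      {r. r < length w \<and> gen_idx (w ! r) = k}"

definition polP :: "complex \<Rightarrow> nat \<Rightarrow> nat \<Rightarrow> nat \<Rightarrow> fa \<Rightarrow> fa" where
  "polP q p k l h = (let c = pbw_coords q p h in
     fa_sum (\<lambda>e. fa_smult (c e / qround q (pbw_deg e k)) (delta_word k l (pbw_word p e)))
       {e. c e \<noteq> 0})"

definition bracket :: "complex \<Rightarrow> nat \<Rightarrow> nat \<Rightarrow> fa" where
  "bracket s i j = fa_minus (fa_smult (inverse s) (w2 (X i) (Y j))) (fa_smult s (w2 (Y i) (X j)))"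

definition omega12 :: "complex \<Rightarrow> complex \<Rightarrow> nat \<Rightarrow> fa \<Rightarrow> fa" where
  "omega12 q s p g = (let c = pbw_coords q p g;
       n = (SOME n. \<forall>e. c e \<noteq> 0 \<longrightarrow> pbw_deg e 2 = n);
       a = (SOME a. valid p a \<and>
              eqH q p g (fa_add (polP q p 2 1 (polP q p 1 2 g)) (fa_mul (bracket s 1 2) a)))
     in fa_smult (qint q (n + 1) / qint q n) a)"

end

theory Submission
  imports Defs "HOL-Library.Multiset"
begin

text \<open>
  The algebra acts on functions of exponent data by weighted shifts, in the way left multiplication
  acts on ordered monomials; this action sends the vacuum to the normal form, so it proves the
  PBW theorem, the relations being checked by moving a letter through one block at a time.
  In PBW coordinates \<open>\<Delta>\<^sub>1\<^sub>2\<close>, \<open>\<Delta>\<^sub>2\<^sub>1\<close> and left multiplication by \<open>(12)\<close> become explicit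
  shift operators, and there is an explicit operator \<open>O\<close> with
  \<open>(12) O = (m) (n+1) - \<Delta>\<^sub>2\<^sub>1 \<Delta>\<^sub>1\<^sub>2\<close> in bidegree \<open>(m, n)\<close>. Since left multiplication by
  \<open>(12)\<close> is injective, the \<open>\<Omega>\<close>-process is \<open>O\<close> divided by \<open>q (m) (n)\<close>. As \<open>\<Delta>\<^sub>2\<^sub>1\<close> commutes with
  \<open>(12)\<close> and \<open>O \<Delta>\<^sub>1\<^sub>2 = q\<^sup>2 \<Delta>\<^sub>1\<^sub>2 O\<close>, applying the expansion to \<open>\<Delta>\<^sub>1\<^sub>2 f\<close> and to \<open>O f\<close> gives it for \<open>f\<close>
  by induction on \<open>m\<close>; the coefficients match because of
  \<open>(m) (n+1) = q\<^bsup>2k\<^esup> (m-k) (n+1-k) + (k) (m+n-k+1)\<close>.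
\<close>

section \<open>The free algebra and the ideal\<close>

text \<open>The obstacle is that equality means membership in an ideal, while
  \<open>pbw_coords\<close> and \<open>omega12\<close> are choice operators: nothing can be computed
  until \<open>eqH\<close> is known to be equality of coordinates. Straightening gives existence of
  coordinates; uniqueness needs a representation that respects the relations. This is manageable
  because a pair x_j, y_j crosses a smaller block by a triangular 2 by 2 matrix of operators on that
  block alone, so all relations follow by induction from ten identities on a single block. The
  identity for (12) O is a quantum Capelli identity, and it forces the weights of O since
  multiplication by (12) is injective. Both functions to which the expansion is applied have first
  degree m - 1, with second degrees n + 1 and n - 1; hence the induction is on m with n arbitrary.
  It concerns arbitrary functions of fixed bidegree; finite support enters when returning to the
  algebra.\<close>

lemmas fa_defs = fa_zero_def fa_word_def fa_add_def fa_minus_def fa_smult_def fa_sum_def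

abbreviation fin :: "fa \<Rightarrow> bool" where "fin a \<equiv> finite (fa_supp a)"

lemma valid_zero [simp]: "valid p fa_zero"
  by (simp add: valid_def fa_supp_def fa_zero_def)

lemma valid_word: "words_in p u \<Longrightarrow> valid p (fa_word u)"
  by (auto simp: valid_def fa_supp_def fa_word_def)

lemma fin_word [simp]: "fin (fa_word u)"
  by (auto simp: fa_supp_def fa_word_def)

lemma fin_add [simp]: "fin a \<Longrightarrow> fin b \<Longrightarrow> fin (fa_add a b)"
  by (rule finite_subset[of _ "fa_supp a \<union> fa_supp b"]) (auto simp: fa_supp_def fa_add_def)

lemma fin_smult [simp]: "fin a \<Longrightarrow> fin (fa_smult c a)"
  by (rule finite_subset[of _ "fa_supp a"]) (auto simp: fa_supp_def fa_smult_def)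

lemma fin_zero [simp]: "fin fa_zero"
  by (simp add: fa_supp_def fa_zero_def)

lemma minus_eq: "fa_minus a b = fa_add a (fa_smult (-1) b)"
  by (simp add: fa_defs)

lemma fin_minus [simp]: "fin a \<Longrightarrow> fin b \<Longrightarrow> fin (fa_minus a b)"
  by (simp add: minus_eq)

lemma valid_fin: "valid p a \<Longrightarrow> fin a"
  by (simp add: valid_def)

lemma valid_add: "valid p a \<Longrightarrow> valid p b \<Longrightarrow> valid p (fa_add a b)"
  unfolding valid_def by (auto, fastforce simp: fa_supp_def fa_add_def)

lemma valid_smult: "valid p a \<Longrightarrow> valid p (fa_smult c a)"
  unfolding valid_def by (auto simp: fa_supp_def fa_smult_def)

lemma valid_minus: "valid p a \<Longrightarrow> valid p b \<Longrightarrow> valid p (fa_minus a b)"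
  by (simp add: minus_eq valid_add valid_smult)

lemma fa_sum_insert:
  "finite A \<Longrightarrow> i \<notin> A \<Longrightarrow> fa_sum g (insert i A) = fa_add (g i) (fa_sum g A)"
  by (simp add: fa_defs)

lemma fa_sum_empty [simp]: "fa_sum g {} = fa_zero"
  by (simp add: fa_defs)

lemma valid_sum: "(\<And>i. i \<in> A \<Longrightarrow> valid p (g i)) \<Longrightarrow> valid p (fa_sum g A)"
proof (induction A rule: infinite_finite_induct)
  case (infinite A)
  then show ?case by (simp add: fa_sum_def valid_def fa_supp_def)
qed (auto simp: fa_sum_insert valid_add)

text \<open>The premise \<open>a u \<noteq> 0\<close> remembers that each added word comes from the
  support of the original element, so that \<open>words_in p u\<close> can be recovered from
  \<open>valid p a\<close>.\<close>

lemma fa_induct [consumes 1, case_names zero step]: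
  assumes "finite (fa_supp a)"
    and "P fa_zero"
    and "\<And>b c u. fin b \<Longrightarrow> a u \<noteq> 0 \<Longrightarrow> P b \<Longrightarrow> P (fa_add b (fa_smult c (fa_word u)))"
  shows "P a"
proof -
  have "P b" if "finite S" "fa_supp b = S" "\<And>w. b w \<noteq> 0 \<Longrightarrow> a w \<noteq> 0" for S b
    using that
  proof (induction S arbitrary: b rule: finite_induct)
    case empty
    then have "b = fa_zero" by (auto simp: fa_supp_def fa_zero_def)
    then show ?case using assms(2) by simp
  next
    case (insert u S)
    define b' where "b' = b(u := 0)"
    have S: "fa_supp b' = S" using insert by (auto simp: fa_supp_def b'_def)
    have sub: "\<And>w. b' w \<noteq> 0 \<Longrightarrow> a w \<noteq> 0"
      using insert.prems(2) by (auto simp: b'_def split: if_splits)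
    have "b = fa_add b' (fa_smult (b u) (fa_word u))"
      by (auto simp: fa_defs b'_def)
    moreover have "a u \<noteq> 0" using insert by (auto simp: fa_supp_def)
    ultimately show ?case
      using assms(3)[of b' u "b u"] insert.IH[OF S sub] S insert.hyps by simp
  qed
  then show ?thesis using assms(1) by blast
qed

section \<open>Bilinear multiplication in the free algebra\<close>

lemma mul_add_left: "fa_mul (fa_add a b) c = fa_add (fa_mul a c) (fa_mul b c)"
  by (simp add: fa_mul_def fa_add_def distrib_right sum.distrib)

lemma mul_add_right: "fa_mul c (fa_add a b) = fa_add (fa_mul c a) (fa_mul c b)"
  by (simp add: fa_mul_def fa_add_def distrib_left sum.distrib)

lemma mul_smult_left: "fa_mul (fa_smult k a) c = fa_smult k (fa_mul a c)"
  by (simp add: fa_mul_def fa_smult_def sum_distrib_left mult.assoc)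

lemma mul_smult_right: "fa_mul c (fa_smult k a) = fa_smult k (fa_mul c a)"
  by (simp add: fa_mul_def fa_smult_def sum_distrib_left mult.left_commute)

lemma mul_zero_left [simp]: "fa_mul fa_zero a = fa_zero"
  by (simp add: fa_mul_def fa_zero_def)

lemma mul_zero_right [simp]: "fa_mul a fa_zero = fa_zero"
  by (simp add: fa_mul_def fa_zero_def)

lemma mul_word: "fa_mul (fa_word u) (fa_word v) = fa_word (u @ v)"
proof
  fix w
  have *: "fa_word u (take k w) * fa_word v (drop k w)
      = (if k = length u then if u @ v = w then 1 else 0 else 0)" if "k \<le> length w" for k
    using that by (auto simp: fa_word_def append_eq_conv_conj)
  have "fa_mul (fa_word u) (fa_word v) w
      = (\<Sum>k\<le>length w. if k = length u then if u @ v = w then 1 else 0 else 0)"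
    unfolding fa_mul_def by (rule sum.cong) (use * in auto)
  also have "\<dots> = fa_word (u @ v) w" by (auto simp: fa_word_def)
  finally show "fa_mul (fa_word u) (fa_word v) w = fa_word (u @ v) w" .
qed

lemma valid_mul:
  assumes "valid p a" "valid p b"
  shows "valid p (fa_mul a b)"
proof -
  have 1: "valid p (fa_mul (fa_word u) b)" if "words_in p u" for u
  proof -
    have "fin b" using assms(2) valid_fin by blast
    then show ?thesis
    proof (induction b rule: fa_induct)
      case (step b' c v)
      have "words_in p v" using step assms(2) by (auto simp: valid_def fa_supp_def)
      then have "words_in p (u @ v)" using that by (auto simp: words_in_def)
      then show ?case
        using step by (simp add: mul_add_right mul_smult_right mul_word valid_add valid_smult valid_word)
    qed simp
  qed
  have "fin a" using assms(1) valid_fin by blast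
  then show ?thesis
  proof (induction a rule: fa_induct)
    case (step b' c v)
    then show ?case
      using 1[of v] assms(1) by (auto simp: mul_add_left mul_smult_left valid_add valid_smult valid_def[of _ a] fa_supp_def)
  qed simp
qed

lemma fin_mul: "fin a \<Longrightarrow> fin b \<Longrightarrow> fin (fa_mul a b)"
proof -
  have 1: "fin b \<Longrightarrow> fin (fa_mul (fa_word u) b)" for u
    by (induction b rule: fa_induct) (simp_all add: mul_add_right mul_smult_right mul_word)
  show "fin a \<Longrightarrow> fin b \<Longrightarrow> fin (fa_mul a b)"
    by (induction a rule: fa_induct) (simp_all add: mul_add_left mul_smult_left 1)
qed

section \<open>The ideal and its congruence\<close>

lemma in_ideal_add: "in_ideal q p b \<Longrightarrow> in_ideal q p a \<Longrightarrow> in_ideal q p (fa_add a b)"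
proof (induction rule: in_ideal.induct)
  case zero
  then show ?case by (simp add: fa_defs)
next
  case (step b r u v c)
  have "fa_add a (fa_add b x) = fa_add (fa_add a b) x" for x by (simp add: fa_defs add.assoc)
  then show ?case using step in_ideal.step by metis
qed

lemma in_ideal_smult: "in_ideal q p b \<Longrightarrow> in_ideal q p (fa_smult k b)"
proof (induction rule: in_ideal.induct)
  case zero
  then show ?case using in_ideal.zero by (simp add: fa_defs)
next
  case (step b r u v c)
  have "fa_smult k (fa_add b (fa_smult c x)) = fa_add (fa_smult k b) (fa_smult (k * c) x)" for x
    by (simp add: fa_defs algebra_simps)
  then show ?case using step in_ideal.step by metis
qed

lemma in_ideal_rel:
  assumes "r \<in> relations q p" "words_in p u" "words_in p v"
  shows "in_ideal q p (fa_mul (fa_word u) (fa_mul r (fa_word v)))"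
  using in_ideal.step[OF in_ideal.zero assms, of 1] by (simp add: fa_defs)

lemma eqH_refl: "eqH q p a a"
  using in_ideal.zero by (simp add: eqH_def fa_defs)

lemma eqH_trans: "eqH q p a b \<Longrightarrow> eqH q p b c \<Longrightarrow> eqH q p a c"
proof -
  have "fa_minus a c = fa_add (fa_minus a b) (fa_minus b c)" by (simp add: fa_defs)
  then show "eqH q p a b \<Longrightarrow> eqH q p b c \<Longrightarrow> eqH q p a c"
    unfolding eqH_def by (simp add: in_ideal_add)
qed

lemma eqH_add: "eqH q p a b \<Longrightarrow> eqH q p c d \<Longrightarrow> eqH q p (fa_add a c) (fa_add b d)"
proof -
  have "fa_minus (fa_add a c) (fa_add b d) = fa_add (fa_minus a b) (fa_minus c d)"
    by (simp add: fa_defs algebra_simps)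
  then show "eqH q p a b \<Longrightarrow> eqH q p c d \<Longrightarrow> eqH q p (fa_add a c) (fa_add b d)"
    unfolding eqH_def by (simp add: in_ideal_add)
qed

lemma eqH_smult: "eqH q p a b \<Longrightarrow> eqH q p (fa_smult k a) (fa_smult k b)"
proof -
  have "fa_minus (fa_smult k a) (fa_smult k b) = fa_smult k (fa_minus a b)"
    by (simp add: fa_defs algebra_simps)
  then show "eqH q p a b \<Longrightarrow> eqH q p (fa_smult k a) (fa_smult k b)"
    unfolding eqH_def by (simp add: in_ideal_smult)
qed

section \<open>Spanning by ordered monomials\<close>

text \<open>Encodes the order x_1 < y_1 < x_2 < y_2 < ... of the letters, for which the ordered
  monomials are exactly the sorted words.\<close>

fun code :: "gen \<Rightarrow> nat" where
  "code (X i) = 2 * i" | "code (Y i) = 2 * i + 1"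

lemma inj_code: "inj code"
proof (rule injI)
  fix x y assume "code x = code y"
  then show "x = y" by (cases x; cases y) (auto, presburger+)
qed

lemma pbw_word_0 [simp]: "pbw_word 0 e = []"
  by (simp add: pbw_word_def)

lemma pbw_word_Suc: "pbw_word (Suc p) e
    = pbw_word p e @ replicate (fst (e (Suc p))) (X (Suc p)) @ replicate (snd (e (Suc p))) (Y (Suc p))"
  by (simp add: pbw_word_def)

lemma pbw_word_idx: "z \<in> set (pbw_word p e) \<Longrightarrow> gen_idx z \<in> {1..p}"
  by (induction p) (auto simp: pbw_word_Suc)

lemma words_in_pbw_word: "words_in p (pbw_word p e)"
  using pbw_word_idx by (auto simp: words_in_def)

lemma code_less: "gen_idx z < gen_idx z' \<Longrightarrow> code z < code z'"
  by (cases z; cases z') auto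

lemma sorted_pbw_word: "sorted (map code (pbw_word p e))"
proof (induction p)
  case (Suc p)
  have "code z \<le> code (X (Suc p))" "code z \<le> code (Y (Suc p))" if "z \<in> set (pbw_word p e)" for z
    using pbw_word_idx[OF that] code_less[of z "X (Suc p)"] code_less[of z "Y (Suc p)"] by simp_all
  then show ?case using Suc by (auto simp: pbw_word_Suc sorted_append)
qed simp

lemma count_pbw_word:
  "count (mset (pbw_word p e)) (X a) = (if a \<in> {1..p} then fst (e a) else 0)"
  "count (mset (pbw_word p e)) (Y a) = (if a \<in> {1..p} then snd (e a) else 0)"
  by (induction p) (auto simp: pbw_word_Suc)

text \<open>A sorted word is determined by its letter multiplicities, and these are the
  exponents.\<close>

lemma sorted_imp_pbw_word:
  assumes "words_in p w" "sorted (map code w)"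
  obtains e where "e \<in> pbw_exps p" "w = pbw_word p e"
proof -
  define e where "e = (\<lambda>a. (count (mset w) (X a), count (mset w) (Y a)))"
  have out: "z \<notin> set w" if "gen_idx z \<notin> {1..p}" for z
    using assms(1) that by (auto simp: words_in_def)
  have e: "e \<in> pbw_exps p"
    using out by (auto simp: pbw_exps_def e_def count_eq_zero_iff)
  have "mset w = mset (pbw_word p e)"
  proof (rule multiset_eqI)
    fix z show "count (mset w) z = count (mset (pbw_word p e)) z"
      using out[of z] by (cases z) (auto simp: count_pbw_word e_def count_eq_zero_iff)
  qed
  then have "mset (map code w) = mset (map code (pbw_word p e))" by simp
  then have "map code w = map code (pbw_word p e)"
    using assms(2) sorted_pbw_word properties_for_sort by metis
  then have "w = pbw_word p e" using inj_code by (simp add: inj_map_eq_map)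
  then show ?thesis using e that by blast
qed

text \<open>Together with \<open>pbw_sum\<close> this names the two halves of the property under the
  \<open>THE\<close> in \<open>pbw_coords\<close>.\<close>

definition fcoord :: "nat \<Rightarrow> ((nat \<Rightarrow> nat \<times> nat) \<Rightarrow> complex) \<Rightarrow> bool" where
  "fcoord p c \<longleftrightarrow> (\<forall>e. c e \<noteq> 0 \<longrightarrow> e \<in> pbw_exps p) \<and> finite {e. c e \<noteq> 0}"

definition pbw_sum :: "nat \<Rightarrow> ((nat \<Rightarrow> nat \<times> nat) \<Rightarrow> complex) \<Rightarrow> fa" where
  "pbw_sum p c = fa_sum (\<lambda>e. fa_smult (c e) (fa_word (pbw_word p e))) {e. c e \<noteq> 0}"

lemma pbw_sum_superset:
  assumes "finite S" "{e. c e \<noteq> 0} \<subseteq> S"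
  shows "pbw_sum p c = fa_sum (\<lambda>e. fa_smult (c e) (fa_word (pbw_word p e))) S"
  unfolding pbw_sum_def fa_sum_def fa_smult_def
  by (rule ext, rule sum.mono_neutral_left) (use assms in auto)

lemma pbw_sum_add:
  assumes "fcoord p c" "fcoord p d"
  shows "fcoord p (\<lambda>e. c e + d e)" "pbw_sum p (\<lambda>e. c e + d e) = fa_add (pbw_sum p c) (pbw_sum p d)"
proof -
  let ?S = "{e. c e \<noteq> 0} \<union> {e. d e \<noteq> 0}"
  have S: "finite ?S" "{e. c e + d e \<noteq> 0} \<subseteq> ?S" using assms by (auto simp: fcoord_def)
  then have "finite {e. c e + d e \<noteq> 0}" using finite_subset by blast
  moreover have "e \<in> pbw_exps p" if "c e + d e \<noteq> 0" for e
    using that assms by (cases "c e = 0") (auto simp: fcoord_def)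
  ultimately show "fcoord p (\<lambda>e. c e + d e)" by (simp add: fcoord_def)
  have 1: "pbw_sum p (\<lambda>e. c e + d e) = fa_sum (\<lambda>e. fa_smult (c e + d e) (fa_word (pbw_word p e))) ?S"
    by (rule pbw_sum_superset) (use S in auto)
  have 2: "pbw_sum p c = fa_sum (\<lambda>e. fa_smult (c e) (fa_word (pbw_word p e))) ?S"
    by (rule pbw_sum_superset) (use S in auto)
  have 3: "pbw_sum p d = fa_sum (\<lambda>e. fa_smult (d e) (fa_word (pbw_word p e))) ?S"
    by (rule pbw_sum_superset) (use S in auto)
  show "pbw_sum p (\<lambda>e. c e + d e) = fa_add (pbw_sum p c) (pbw_sum p d)"
    unfolding 1 2 3 by (simp add: fa_defs distrib_right sum.distrib)
qed

lemma pbw_sum_smult: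
  assumes "fcoord p c"
  shows "fcoord p (\<lambda>e. k * c e)" "pbw_sum p (\<lambda>e. k * c e) = fa_smult k (pbw_sum p c)"
proof -
  have S: "finite {e. c e \<noteq> 0}" "{e. k * c e \<noteq> 0} \<subseteq> {e. c e \<noteq> 0}" using assms by (auto simp: fcoord_def)
  then have "finite {e. k * c e \<noteq> 0}" using finite_subset by blast
  then show "fcoord p (\<lambda>e. k * c e)" using assms by (auto simp: fcoord_def)
  have "pbw_sum p (\<lambda>e. k * c e) = fa_sum (\<lambda>e. fa_smult (k * c e) (fa_word (pbw_word p e))) {e. c e \<noteq> 0}"
    by (rule pbw_sum_superset) (use S in auto)
  then show "pbw_sum p (\<lambda>e. k * c e) = fa_smult k (pbw_sum p c)"
    by (simp add: pbw_sum_def fa_defs sum_distrib_left mult.assoc)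
qed

lemma valid_pbw_sum: "valid p (pbw_sum p c)"
  unfolding pbw_sum_def by (intro valid_sum valid_smult valid_word words_in_pbw_word)

definition spanned :: "complex \<Rightarrow> nat \<Rightarrow> fa \<Rightarrow> bool" where
  "spanned q p h \<longleftrightarrow> (\<exists>c. fcoord p c \<and> eqH q p h (pbw_sum p c))"

lemma spanned_zero: "spanned q p fa_zero"
  unfolding spanned_def
  by (rule exI[of _ "\<lambda>_. 0"]) (simp add: fcoord_def pbw_sum_def eqH_refl)

lemma spanned_add: "spanned q p a \<Longrightarrow> spanned q p b \<Longrightarrow> spanned q p (fa_add a b)"
  unfolding spanned_def using pbw_sum_add eqH_add by metis

lemma spanned_smult: "spanned q p a \<Longrightarrow> spanned q p (fa_smult k a)"
  unfolding spanned_def using pbw_sum_smult eqH_smult by metis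

lemma spanned_eqH: "eqH q p a b \<Longrightarrow> spanned q p b \<Longrightarrow> spanned q p a"
  unfolding spanned_def using eqH_trans by metis

lemma spanned_pbw_word:
  assumes "e \<in> pbw_exps p"
  shows "spanned q p (fa_word (pbw_word p e))"
  unfolding spanned_def
proof (intro exI conjI)
  show "fcoord p (\<lambda>e'. if e' = e then 1 else 0)"
    using assms by (auto simp: fcoord_def)
  have "pbw_sum p (\<lambda>e'. if e' = e then 1 else 0) = fa_word (pbw_word p e)"
    by (subst pbw_sum_superset[of "{e}"]) (auto simp: fa_defs)
  then show "eqH q p (fa_word (pbw_word p e)) (pbw_sum p (\<lambda>e'. if e' = e then 1 else 0))"
    by (simp add: eqH_refl)
qed

lemma relationsI:
  "i \<in> {1..p} \<Longrightarrow> fa_minus (w2 (X i) (Y i)) (fa_smult q (w2 (Y i) (X i))) \<in> relations q p"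
  "1 \<le> i \<Longrightarrow> i < j \<Longrightarrow> j \<le> p \<Longrightarrow> fa_minus (w2 (X j) (X i)) (fa_smult (q^2) (w2 (X i) (X j))) \<in> relations q p"
  "1 \<le> i \<Longrightarrow> i < j \<Longrightarrow> j \<le> p \<Longrightarrow> fa_minus (w2 (Y j) (Y i)) (fa_smult (q^2) (w2 (Y i) (Y j))) \<in> relations q p"
  "1 \<le> i \<Longrightarrow> i < j \<Longrightarrow> j \<le> p \<Longrightarrow> fa_minus (w2 (X j) (Y i))
     (fa_add (fa_smult q (w2 (Y i) (X j))) (fa_smult (q^2 - 1) (w2 (X i) (Y j)))) \<in> relations q p"
  "1 \<le> i \<Longrightarrow> i < j \<Longrightarrow> j \<le> p \<Longrightarrow> fa_minus (w2 (Y j) (X i)) (fa_smult q (w2 (X i) (Y j))) \<in> relations q p"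
  unfolding relations_def by blast+

text \<open>One shape for all five relations, so that straightening needs a single case. A relation
  with one term on the right gets a second term with coefficient 0. The scalar \<open>k\<close>
  absorbs the relation x_i y_i = q y_i x_i, whose descent is on its right side. Only the first
  letter of each new pair has to drop, since that decides the lexicographic comparison.\<close>

lemma descent_rewrite:
  assumes "q \<noteq> 0" "code z' < code z" "gen_idx z \<in> {1..p}" "gen_idx z' \<in> {1..p}"
  obtains k r c1 c2 a b a' b' where "r \<in> relations q p"
    "fa_minus (w2 z z') (fa_add (fa_smult c1 (w2 a b)) (fa_smult c2 (w2 a' b'))) = fa_smult k r"
    "code a < code z" "code a' < code z" "{gen_idx a, gen_idx b, gen_idx a', gen_idx b'} \<subseteq> {1..p}"
proof -
  have one: "fa_smult 1 x = x" for x by (simp add: fa_defs)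
  have dup: "fa_add (fa_smult c x) (fa_smult 0 x) = fa_smult c x" for c x by (simp add: fa_defs)
  have less: "gen_idx z' \<le> gen_idx z" "gen_idx z' = gen_idx z \<Longrightarrow> \<exists>i. z = Y i \<and> z' = X i"
    using assms(2) by (cases z; cases z'; auto)+
  consider (yx) i where "z = Y i" "z' = X i" | (xx) i j where "z = X j" "z' = X i" "i < j"
    | (yy) i j where "z = Y j" "z' = Y i" "i < j" | (xy) i j where "z = X j" "z' = Y i" "i < j"
    | (yx') i j where "z = Y j" "z' = X i" "i < j"
    using less by (cases z; cases z') (auto simp: le_less)
  then show ?thesis
  proof cases
    case yx
    let ?r = "fa_minus (w2 (X i) (Y i)) (fa_smult q (w2 (Y i) (X i)))"
    have "fa_minus (w2 z z') (fa_smult (inverse q) (w2 (X i) (Y i))) = fa_smult (- inverse q) ?r"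
      using assms(1) yx by (simp add: fa_defs fun_eq_iff field_simps)
    then show ?thesis
      using assms yx by (intro that[OF relationsI(1), of i "inverse q" "X i" "Y i" 0 "X i" "Y i" "- inverse q"])
        (simp_all add: dup)
  next
    case xx
    then show ?thesis
      using assms by (intro that[OF relationsI(2), of i j "q^2" "X i" "X j" 0 "X i" "X j" 1])
        (simp_all add: dup one)
  next
    case yy
    then show ?thesis
      using assms by (intro that[OF relationsI(3), of i j "q^2" "Y i" "Y j" 0 "Y i" "Y j" 1])
        (simp_all add: dup one)
  next
    case xy
    then show ?thesis
      using assms by (intro that[OF relationsI(4), of i j q "Y i" "X j" "q^2 - 1" "X i" "Y j" 1])
        (simp_all add: one)
  next
    case yx'
    then show ?thesis
      using assms by (intro that[OF relationsI(5), of i j q "X i" "Y j" 0 "X i" "Y j" 1])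
        (simp_all add: dup one)
  qed
qed

lemma mul_minus_left: "fa_mul (fa_minus a b) c = fa_minus (fa_mul a c) (fa_mul b c)"
  by (simp add: minus_eq mul_add_left mul_smult_left)

lemma mul_minus_right: "fa_mul c (fa_minus a b) = fa_minus (fa_mul c a) (fa_mul c b)"
  by (simp add: minus_eq mul_add_right mul_smult_right)

text \<open>Straightening terminates because a rewrite at a descent keeps the length and lowers the
  list of codes lexicographically.\<close>

lemma spanned_word:
  assumes "q \<noteq> 0"
  shows "words_in p w \<Longrightarrow> spanned q p (fa_word w)"
proof (induction w rule: wf_induct_rule[OF wf_inv_image[OF wf_lenlex[OF wf_less_than], of "map code"]])
  case (1 w)
  show ?case
  proof (cases "sorted (map code w)")
    case True
    then show ?thesis using sorted_imp_pbw_word[OF 1(2)] spanned_pbw_word by metis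
  next
    case False
    then obtain i where i: "Suc i < length w" "code (w ! Suc i) < code (w ! i)"
      by (auto simp: sorted_iff_nth_Suc not_le)
    define u v z z' where "u = take i w" "v = drop (Suc (Suc i)) w" "z = w ! i" "z' = w ! Suc i"
    have w: "w = u @ [z, z'] @ v"
      using i id_take_nth_drop[of i w] Cons_nth_drop_Suc[of "Suc i" w] by (simp add: u_v_z_z'_def)
    have in_p: "words_in p u" "words_in p v" "gen_idx z \<in> {1..p}" "gen_idx z' \<in> {1..p}"
      using 1(2) unfolding w words_in_def by auto
    obtain k r c1 c2 a b a' b' where r: "r \<in> relations q p"
      and eq: "fa_minus (w2 z z') (fa_add (fa_smult c1 (w2 a b)) (fa_smult c2 (w2 a' b'))) = fa_smult k r"
      and less: "code a < code z" "code a' < code z"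
      and idx: "{gen_idx a, gen_idx b, gen_idx a', gen_idx b'} \<subseteq> {1..p}"
      using descent_rewrite[OF assms _ in_p(3,4)] i by (metis u_v_z_z'_def(3,4))
    have "in_ideal q p (fa_smult k (fa_mul (fa_word u) (fa_mul r (fa_word v))))"
      using in_ideal_smult in_ideal_rel r in_p by blast
    also have "fa_smult k (fa_mul (fa_word u) (fa_mul r (fa_word v)))
        = fa_mul (fa_word u) (fa_mul (fa_smult k r) (fa_word v))"
      by (simp add: mul_smult_left mul_smult_right)
    also have "\<dots> = fa_minus (fa_word w)
        (fa_add (fa_smult c1 (fa_word (u @ [a, b] @ v))) (fa_smult c2 (fa_word (u @ [a', b'] @ v))))"
      unfolding eq[symmetric]
      by (simp add: w2_def w mul_minus_left mul_minus_right mul_add_left mul_add_right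
          mul_smult_left mul_smult_right mul_word)
    finally have "eqH q p (fa_word w)
        (fa_add (fa_smult c1 (fa_word (u @ [a, b] @ v))) (fa_smult c2 (fa_word (u @ [a', b'] @ v))))"
      by (simp add: eqH_def)
    moreover have "spanned q p (fa_word (u @ [x, y] @ v))"
      if "code x < code z" "gen_idx x \<in> {1..p}" "gen_idx y \<in> {1..p}" for x y
    proof (rule 1(1))
      show "(u @ [x, y] @ v, w) \<in> inv_image (lenlex less_than) (map code)"
      proof -
        have "(map code (u @ [x, y] @ v), map code w) \<in> lex less_than"
          using lex_append_leftI[of "map code ([x, y] @ v)" "map code ([z, z'] @ v)" less_than "map code u"] that
          by (simp add: w)
        then show ?thesis by (simp add: lenlex_conv w)
      qed
      show "words_in p (u @ [x, y] @ v)" using that in_p by (auto simp: words_in_def)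
    qed
    ultimately show ?thesis
      using less idx by (elim spanned_eqH) (intro spanned_add spanned_smult, simp_all)
  qed
qed

lemma spanned_valid:
  assumes "q \<noteq> 0" "valid p h"
  shows "spanned q p h"
proof -
  have "fin h" using assms(2) valid_fin by blast
  then show ?thesis
  proof (induction h rule: fa_induct)
    case (step b c u)
    have "words_in p u" using step assms by (auto simp: valid_def fa_supp_def)
    then show ?case using step assms spanned_add spanned_smult spanned_word by blast
  qed (rule spanned_zero)
qed

section \<open>A representation separating ordered monomials\<close>

type_synonym coord = "(nat \<Rightarrow> nat \<times> nat) \<Rightarrow> complex"

text \<open>A coordinate function is read by pullback: the new coefficient at \<open>e\<close> comes
  from the old one at the source monomial. Multiplication raises exponents, so
  \<open>\<sigma>\<close> lowers them, and \<open>\<phi>\<close> must vanish where truncated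
  subtraction gives no true source.\<close>

definition wshift :: "nat \<Rightarrow> (nat \<times> nat \<Rightarrow> complex) \<Rightarrow> (nat \<times> nat \<Rightarrow> nat \<times> nat) \<Rightarrow> coord \<Rightarrow> coord" where
  "wshift k \<phi> \<sigma> c = (\<lambda>e. \<phi> (e k) * c (e(k := \<sigma> (e k))))"

lemma wshift_commute:
  "j \<noteq> k \<Longrightarrow> wshift k \<phi> \<sigma> (wshift j \<psi> \<tau> c) = wshift j \<psi> \<tau> (wshift k \<phi> \<sigma> c)"
  by (auto simp: wshift_def fun_upd_twist)

definition linop :: "(coord \<Rightarrow> coord) \<Rightarrow> bool" where
  "linop T \<longleftrightarrow> (\<forall>x y. T (\<lambda>e. x e + y e) = (\<lambda>e. T x e + T y e)) \<and> (\<forall>k x. T (\<lambda>e. k * x e) = (\<lambda>e. k * T x e))"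

lemma linop_add: "linop T \<Longrightarrow> T (\<lambda>e. x e + y e) = (\<lambda>e. T x e + T y e)"
  and linop_smult: "linop T \<Longrightarrow> T (\<lambda>e. k * x e) = (\<lambda>e. k * T x e)"
  by (auto simp: linop_def)

lemma linop_zero: "linop T \<Longrightarrow> T (\<lambda>e. 0) = (\<lambda>e. 0)"
  using linop_smult[of T 0 "\<lambda>e. 0"] by simp

lemma linop_sum: "linop T \<Longrightarrow> T (\<lambda>e. \<Sum>i\<in>A. g i e) = (\<lambda>e. \<Sum>i\<in>A. T (g i) e)"
proof (induction A rule: infinite_finite_induct)
  case (insert x F)
  then show ?case using linop_add[of T "g x" "\<lambda>e. \<Sum>i\<in>F. g i e"] by simp
qed (simp_all add: linop_zero)

lemma linop_wshift [simp]: "linop (wshift k \<phi> \<sigma>)"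
  by (auto simp: linop_def wshift_def algebra_simps)

lemma linop_comp: "linop S \<Longrightarrow> linop T \<Longrightarrow> linop (\<lambda>c. S (T c))"
  by (simp add: linop_def)

lemma linop_plus: "linop S \<Longrightarrow> linop T \<Longrightarrow> linop (\<lambda>c e. S c e + T c e)"
  by (auto simp: linop_def algebra_simps)

locale qplane =
  fixes q s :: complex
  assumes s2: "s ^ 2 = q" and q0: "q \<noteq> 0" and generic: "\<And>d::nat. d \<ge> 1 \<Longrightarrow> q ^ (2 * d) \<noteq> 1"
begin

lemma s0: "s \<noteq> 0"
  using s2 q0 by auto

lemma q2_neq_1: "q ^ 2 \<noteq> 1"
  using generic[of 1] by simp

section \<open>The integers (m)\<close>

lemma qround_0 [simp]: "qround q 0 = 0"
  by (simp add: qround_def)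

lemma qround_Suc: "qround q (Suc m) = qround q m + q ^ (2 * m)"
proof -
  have "q ^ 2 - 1 \<noteq> 0" using q2_neq_1 by simp
  then show ?thesis by (simp add: qround_def field_simps power2_eq_square)
qed

lemma qround_eq: "(q ^ 2 - 1) * qround q m = q ^ (2 * m) - 1"
  using q2_neq_1 by (simp add: qround_def)

lemma qround_neq_0: "m \<ge> 1 \<Longrightarrow> qround q m \<noteq> 0"
  using generic[of m] q2_neq_1 by (simp add: qround_def)

text \<open>Left multiplication by the letters of block k on that block; the weight of
  \<open>Yop\<close> comes from y x^a = q^(-a) x^a y.\<close>

definition "Xop k = wshift k (\<lambda>(a, b). if a = 0 then 0 else 1) (\<lambda>(a, b). (a - 1, b))"
definition "Yop k = wshift k (\<lambda>(a, b). if b = 0 then 0 else inverse (q ^ a)) (\<lambda>(a, b). (a, b - 1))"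
text \<open>Moving \<open>x\<^sub>j\<close> or \<open>y\<^sub>j\<close> leftwards through the block \<open>x\<^sub>k\<^sup>a y\<^sub>k\<^sup>b\<close> of a smaller index:
  \<open>x\<^sub>j\<close> becomes \<open>Aop k\<close> times \<open>x\<^sub>j\<close> plus \<open>Cop k\<close> times \<open>y\<^sub>j\<close>, and \<open>y\<^sub>j\<close> becomes \<open>Dop k\<close> times \<open>y\<^sub>j\<close>.\<close>
definition "Aop k = wshift k (\<lambda>(a, b). q ^ (2 * a + b)) (\<lambda>v. v)"
definition "Dop k = wshift k (\<lambda>(a, b). q ^ (a + 2 * b)) (\<lambda>v. v)"
definition "Cop k = wshift k (\<lambda>(a, b). if a = 0 then 0 else q ^ (2 * (a - 1)) * (q ^ 2 - 1) * qround q (b + 1))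
    (\<lambda>(a, b). (a - 1, b + 1))"

lemmas op_defs = Xop_def Yop_def Aop_def Dop_def Cop_def

text \<open>\<open>LY d k\<close> and \<open>LX d k\<close> are left multiplication by y_(k+d) and
  x_(k+d) on the blocks from k on. The distance \<open>d\<close> drops by one with each block
  crossed.\<close>

primrec LY :: "nat \<Rightarrow> nat \<Rightarrow> coord \<Rightarrow> coord" where
  "LY 0 k c = Yop k c"
| "LY (Suc d) k c = Dop k (LY d (Suc k) c)"

primrec LX :: "nat \<Rightarrow> nat \<Rightarrow> coord \<Rightarrow> coord" where
  "LX 0 k c = Xop k c"
| "LX (Suc d) k c = (\<lambda>e. Aop k (LX d (Suc k) c) e + Cop k (LY d (Suc k) c) e)"

lemma linop_ops [simp]: "linop (Xop k)" "linop (Yop k)" "linop (Aop k)" "linop (Dop k)" "linop (Cop k)"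
  by (simp_all add: op_defs)

lemma linop_LY [simp]: "linop (LY d k)"
proof (induction d arbitrary: k)
  case 0
  have "LY 0 k = Yop k" by (rule ext) simp
  then show ?case by simp
next
  case (Suc d)
  have "LY (Suc d) k = (\<lambda>c. Dop k (LY d (Suc k) c))" by (rule ext) simp
  then show ?case by (simp add: linop_comp Suc)
qed

lemma linop_LX [simp]: "linop (LX d k)"
proof (induction d arbitrary: k)
  case 0
  have "LX 0 k = Xop k" by (rule ext) simp
  then show ?case by simp
next
  case (Suc d)
  have "LX (Suc d) k = (\<lambda>c e. Aop k (LX d (Suc k) c) e + Cop k (LY d (Suc k) c) e)"
    by (rule ext) simp
  then show ?case by (simp add: linop_plus linop_comp Suc)
qed

lemmas op_linear =
  linop_add[OF linop_ops(1)] linop_add[OF linop_ops(2)] linop_add[OF linop_ops(3)]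
  linop_add[OF linop_ops(4)] linop_add[OF linop_ops(5)]
  linop_smult[OF linop_ops(1)] linop_smult[OF linop_ops(2)] linop_smult[OF linop_ops(3)]
  linop_smult[OF linop_ops(4)] linop_smult[OF linop_ops(5)]

lemma LY_wshift: "k < j \<Longrightarrow> LY d j (wshift k \<phi> \<sigma> c) = wshift k \<phi> \<sigma> (LY d j c)"
  by (induction d arbitrary: j) (simp_all add: Yop_def Dop_def wshift_commute)

lemma LX_wshift: "k < j \<Longrightarrow> LX d j (wshift k \<phi> \<sigma> c) = wshift k \<phi> \<sigma> (LX d j c)"
  by (induction d arbitrary: j)
    (simp_all add: Xop_def Aop_def Cop_def wshift_commute LY_wshift linop_add[OF linop_wshift])

lemma L_ops:
  assumes "k < j"
  shows "LX d j (Xop k c) = Xop k (LX d j c)" "LY d j (Xop k c) = Xop k (LY d j c)"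
    "LX d j (Yop k c) = Yop k (LX d j c)" "LY d j (Yop k c) = Yop k (LY d j c)"
    "LX d j (Aop k c) = Aop k (LX d j c)" "LY d j (Aop k c) = Aop k (LY d j c)"
    "LX d j (Cop k c) = Cop k (LX d j c)" "LY d j (Cop k c) = Cop k (LY d j c)"
    "LX d j (Dop k c) = Dop k (LX d j c)" "LY d j (Dop k c) = Dop k (LY d j c)"
  using assms by (simp_all add: op_defs LX_wshift LY_wshift)

text \<open>The first identity concerns two letters of block k, the next six a letter of the block
  and one crossing it, the last three two letters crossing it. These are all the cases met in the
  induction over blocks.\<close>

lemma local_rels:
  "Xop k (Yop k c) e = q * Yop k (Xop k c) e"
  "Aop k (Xop k c) e = q ^ 2 * Xop k (Aop k c) e"
  "Cop k (Xop k c) e = q ^ 2 * Xop k (Cop k c) e"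
  "Aop k (Yop k c) e = q * Yop k (Aop k c) e"
  "Cop k (Yop k c) e = q * Yop k (Cop k c) e + (q ^ 2 - 1) * Xop k (Dop k c) e"
  "Dop k (Yop k c) e = q ^ 2 * Yop k (Dop k c) e"
  "Dop k (Xop k c) e = q * Xop k (Dop k c) e"
  "Aop k (Cop k c) e = q * Cop k (Aop k c) e"
  "Cop k (Dop k c) e = q * Dop k (Cop k c) e"
  "Dop k (Aop k c) e = Aop k (Dop k c) e"
proof -
  obtain a b where e: "e k = (a, b)" by fastforce
  have q: "(q ^ 2 - 1) * qround q m = q ^ (2 * m) - 1" for m by (rule qround_eq)
  note [simp] = op_defs wshift_def e q0
  show "Xop k (Yop k c) e = q * Yop k (Xop k c) e"
    by (cases a; cases b) (simp_all add: field_simps)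
  show "Aop k (Xop k c) e = q ^ 2 * Xop k (Aop k c) e"
    by (cases a) (simp_all add: power_add power2_eq_square)
  show "Cop k (Xop k c) e = q ^ 2 * Xop k (Cop k c) e"
  proof (cases a)
    case (Suc a')
    then show ?thesis by (cases a') (simp_all add: power2_eq_square power_mult)
  qed simp
  show "Aop k (Yop k c) e = q * Yop k (Aop k c) e"
    by (cases b) (simp_all add: power_add power_mult power2_eq_square)
  show "Dop k (Yop k c) e = q ^ 2 * Yop k (Dop k c) e"
    by (cases b) (simp_all add: power_add power_mult power2_eq_square)
  show "Dop k (Xop k c) e = q * Xop k (Dop k c) e"
    by (cases a) (simp_all add: power_add power_mult power2_eq_square)
  show "Aop k (Cop k c) e = q * Cop k (Aop k c) e"
    by (cases a) (simp_all add: power_add power_mult power2_eq_square)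
  show "Cop k (Dop k c) e = q * Dop k (Cop k c) e"
    by (cases a) (simp_all add: power_add power_mult power2_eq_square)
  show "Dop k (Aop k c) e = Aop k (Dop k c) e"
    by simp
  show "Cop k (Yop k c) e = q * Yop k (Cop k c) e + (q ^ 2 - 1) * Xop k (Dop k c) e"
  proof (cases a)
    case (Suc a')
    show ?thesis
    proof (cases b)
      case 0
      then show ?thesis using Suc qround_Suc[of 0] by (simp add: field_simps power_mult power2_eq_square)
    next
      case b: (Suc b')
      have q': "(q ^ 2 - 1) * (qround q m * x) = (q ^ (2 * m) - 1) * x" for m x
        using q[of m] by (simp only: mult.assoc[symmetric])
      have 1: "inverse (q ^ a) * q = inverse (q ^ a')" "inverse (q ^ a') * q ^ (2 * a') = q ^ a'"
        using Suc by (simp_all add: field_simps power_mult power2_eq_square)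
      \<comment> \<open>With the powers of q collected, the claim is q^(2(b+1)) - 1 = (q^(2b) - 1) +
        (q^2 - 1) q^(2b).\<close>
      have E1: "Cop k (Yop k c) e = (q ^ (2 * (b + 1)) - 1) * (inverse (q ^ a') * q ^ (2 * a') * c (e(k := (a', b))))"
        using Suc b q'[of "b + 1"] by (simp add: mult_ac)
      have E2: "q * Yop k (Cop k c) e = (q ^ (2 * b) - 1) * ((inverse (q ^ a) * q) * q ^ (2 * a') * c (e(k := (a', b))))"
        using Suc b q'[of "b"] by (simp add: mult_ac)
      have E3: "Xop k (Dop k c) e = q ^ a' * q ^ (2 * b) * c (e(k := (a', b)))"
        using Suc b by (simp add: power_add)
      show ?thesis
        unfolding E1 E2 E3 1 by (simp add: algebra_simps power2_eq_square del: op_defs wshift_def)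
    qed
  qed (cases b, simp_all)
qed

lemma rel_XY: "LX d k (LY d k c) e = q * LY d k (LX d k c) e"
proof (induction d arbitrary: k c e)
  case 0
  then show ?case by (simp add: local_rels)
next
  case (Suc d)
  have IH: "LX d (Suc k) (LY d (Suc k) x) = (\<lambda>e. q * LY d (Suc k) (LX d (Suc k) x) e)" for x
    using Suc by auto
  show ?case
    by (simp add: L_ops IH linop_add[OF linop_LX] linop_add[OF linop_LY] op_linear local_rels) (simp add: algebra_simps)
qed

text \<open>Induction on the distance of the smaller letter. At distance 0 it lies in block k while
  the other letter crosses; otherwise both cross block k and the remaining blocks are handled by the
  induction hypothesis.\<close>

lemma rel_shifted:
  assumes "d < d'"
  shows "LX d' k (LX d k c) e = q ^ 2 * LX d k (LX d' k c) e"
    "LY d' k (LY d k c) e = q ^ 2 * LY d k (LY d' k c) e"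
    "LX d' k (LY d k c) e = q * LY d k (LX d' k c) e + (q ^ 2 - 1) * LX d k (LY d' k c) e"
    "LY d' k (LX d k c) e = q * LX d k (LY d' k c) e"
proof -
  \<comment> \<open>The four relations are proved together, because crossing a block turns x partly
    into y and so mixes them.\<close>
  have "LX d' k (LX d k c) e = q ^ 2 * LX d k (LX d' k c) e \<and>
    LY d' k (LY d k c) e = q ^ 2 * LY d k (LY d' k c) e \<and>
    LX d' k (LY d k c) e = q * LY d k (LX d' k c) e + (q ^ 2 - 1) * LX d k (LY d' k c) e \<and>
    LY d' k (LX d k c) e = q * LX d k (LY d' k c) e"
    using assms
  proof (induction d arbitrary: d' k c e)
    case 0
    then obtain d'' where "d' = Suc d''" by (cases d') auto
    then show ?case
      by (simp add: L_ops linop_add[OF linop_LX] linop_add[OF linop_LY] op_linear local_rels) (simp add: algebra_simps)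
  next
    case (Suc d)
    then obtain d'' where d: "d' = Suc d''" "d < d''" by (cases d') auto
    have IH: "LX d'' (Suc k) (LX d (Suc k) x) = (\<lambda>e. q ^ 2 * LX d (Suc k) (LX d'' (Suc k) x) e)"
      "LY d'' (Suc k) (LY d (Suc k) x) = (\<lambda>e. q ^ 2 * LY d (Suc k) (LY d'' (Suc k) x) e)"
      "LX d'' (Suc k) (LY d (Suc k) x) = (\<lambda>e. q * LY d (Suc k) (LX d'' (Suc k) x) e
        + (q ^ 2 - 1) * LX d (Suc k) (LY d'' (Suc k) x) e)"
      "LY d'' (Suc k) (LX d (Suc k) x) = (\<lambda>e. q * LX d (Suc k) (LY d'' (Suc k) x) e)" for x
      using Suc.IH[OF d(2)] by auto
    have q2: "q ^ 2 = q * q" by (rule power2_eq_square)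
    show ?case
      unfolding d(1) by (simp add: L_ops IH linop_add[OF linop_LX] linop_add[OF linop_LY] op_linear local_rels)
        (simp add: algebra_simps q2)
  qed
  then show "LX d' k (LX d k c) e = q ^ 2 * LX d k (LX d' k c) e"
    "LY d' k (LY d k c) e = q ^ 2 * LY d k (LY d' k c) e"
    "LX d' k (LY d k c) e = q * LY d k (LX d' k c) e + (q ^ 2 - 1) * LX d k (LY d' k c) e"
    "LY d' k (LX d k c) e = q * LX d k (LY d' k c) e"
    by blast+
qed

section \<open>The action of the free algebra\<close>

fun gact :: "gen \<Rightarrow> coord \<Rightarrow> coord" where
  "gact (X j) = LX (j - 1) 1" | "gact (Y j) = LY (j - 1) 1"

lemma linop_gact [simp]: "linop (gact z)"
  by (cases z) simp_all

definition wact :: "gen list \<Rightarrow> coord \<Rightarrow> coord" where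
  "wact w c = foldr gact w c"

lemma wact_simps [simp]: "wact [] c = c" "wact (z # w) c = gact z (wact w c)"
  by (simp_all add: wact_def)

lemma wact_append: "wact (u @ v) c = wact u (wact v c)"
  by (simp add: wact_def)

lemma linop_wact [simp]: "linop (wact w)"
proof (induction w)
  case Nil
  then show ?case by (simp add: linop_def)
next
  case (Cons z w)
  have "wact (z # w) = (\<lambda>c. gact z (wact w c))" by (rule ext) simp
  then show ?case using Cons by (simp add: linop_comp)
qed

definition act :: "fa \<Rightarrow> coord \<Rightarrow> coord" where
  "act h c = (\<lambda>e. \<Sum>w\<in>fa_supp h. h w * wact w c e)"

lemma act_superset:
  "finite S \<Longrightarrow> fa_supp h \<subseteq> S \<Longrightarrow> act h c = (\<lambda>e. \<Sum>w\<in>S. h w * wact w c e)"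
  unfolding act_def by (rule ext, rule sum.mono_neutral_left) (auto simp: fa_supp_def)

lemma act_zero [simp]: "act fa_zero c = (\<lambda>e. 0)"
  by (simp add: act_def fa_zero_def)

lemma act_word [simp]: "act (fa_word u) c = wact u c"
  by (subst act_superset[of "{u}"]) (auto simp: fa_supp_def fa_word_def)

lemma act_add:
  assumes "fin a" "fin b"
  shows "act (fa_add a b) c = (\<lambda>e. act a c e + act b c e)"
proof -
  let ?S = "fa_supp a \<union> fa_supp b"
  have S: "finite ?S" using assms by simp
  have "act (fa_add a b) c = (\<lambda>e. \<Sum>w\<in>?S. fa_add a b w * wact w c e)"
    by (rule act_superset[OF S]) (auto simp: fa_supp_def fa_add_def)
  moreover have "act a c = (\<lambda>e. \<Sum>w\<in>?S. a w * wact w c e)" "act b c = (\<lambda>e. \<Sum>w\<in>?S. b w * wact w c e)"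
    by (rule act_superset[OF S], blast)+
  ultimately show ?thesis by (simp add: fa_add_def distrib_right sum.distrib)
qed

lemma act_smult:
  assumes "fin a"
  shows "act (fa_smult k a) c = (\<lambda>e. k * act a c e)"
proof -
  have "act (fa_smult k a) c = (\<lambda>e. \<Sum>w\<in>fa_supp a. fa_smult k a w * wact w c e)"
    by (rule act_superset) (use assms in \<open>auto simp: fa_supp_def fa_smult_def\<close>)
  then show ?thesis by (simp add: act_def fa_smult_def sum_distrib_left mult.assoc)
qed

lemma act_minus: "fin a \<Longrightarrow> fin b \<Longrightarrow> act (fa_minus a b) c = (\<lambda>e. act a c e - act b c e)"
  by (simp add: minus_eq act_add act_smult)

lemma act_sum:
  assumes "finite A" "\<And>i. i \<in> A \<Longrightarrow> fin (g i)"
  shows "fin (fa_sum g A) \<and> act (fa_sum g A) c = (\<lambda>e. \<Sum>i\<in>A. act (g i) c e)"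
  using assms by (induction A rule: finite_induct) (simp_all add: fa_sum_insert act_add)

lemma act_mul: "fin a \<Longrightarrow> fin b \<Longrightarrow> act (fa_mul a b) c = act a (act b c)"
proof -
  have 1: "act (fa_mul (fa_word u) b) c = wact u (act b c)" if "fin b" for u
    using that
    by (induction b rule: fa_induct)
      (simp_all add: linop_zero mul_add_right mul_smult_right mul_word wact_append act_add act_smult
        fin_mul linop_add[OF linop_wact] linop_smult[OF linop_wact])
  show "fin a \<Longrightarrow> fin b \<Longrightarrow> act (fa_mul a b) c = act a (act b c)"
    by (induction a rule: fa_induct)
      (simp_all add: mul_add_left mul_smult_left act_add act_smult fin_mul 1)
qed

lemma act_relation:
  assumes "r \<in> relations q p"
  shows "fin r" "act r c = (\<lambda>e. 0)"
proof -
  have w2: "fin (w2 a b)" "act (w2 a b) c = gact a (gact b c)" for a b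
    by (simp_all add: w2_def)
  have less: "i - 1 < j - 1" if "1 \<le> i" "i < j" for i j :: nat using that by simp
  show "fin r" using assms w2 by (auto simp: relations_def)
  show "act r c = (\<lambda>e. 0)"
    using assms less by (auto simp: relations_def act_minus act_add act_smult w2 rel_XY rel_shifted)
qed

text \<open>Finiteness of the support is carried along because additivity of \<open>act\<close> is
  available for finitely supported elements.\<close>

lemma act_ideal: "in_ideal q p a \<Longrightarrow> fin a \<and> act a c = (\<lambda>e. 0)"
proof (induction rule: in_ideal.induct)
  case (step a r u v k)
  then show ?case
    by (simp add: act_relation fin_mul act_add act_smult act_mul linop_zero)
qed simp


section \<open>The action on single monomials\<close>

definition delta :: "(nat \<Rightarrow> nat \<times> nat) \<Rightarrow> coord" where
  "delta e = (\<lambda>e'. if e' = e then 1 else 0)"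

text \<open>The pullback moves the point mass to the source \<open>w\<close> of \<open>e k\<close>
  under \<open>\<sigma>\<close>; further preimages, such as those created by truncated subtraction,
  must carry weight 0.\<close>

lemma wshift_delta:
  assumes "\<sigma> w = e k" "\<And>v. v \<noteq> w \<Longrightarrow> \<sigma> v = e k \<Longrightarrow> \<phi> v = 0"
  shows "wshift k \<phi> \<sigma> (delta e) = (\<lambda>e'. \<phi> w * delta (e(k := w)) e')"
proof
  fix e'
  show "wshift k \<phi> \<sigma> (delta e) e' = \<phi> w * delta (e(k := w)) e'"
  proof (cases "e' = e(k := w)")
    case True
    then show ?thesis using assms(1) by (simp add: wshift_def delta_def)
  next
    case False
    have "\<phi> (e' k) = 0" if "e'(k := \<sigma> (e' k)) = e"
    proof (rule assms(2))
      show "\<sigma> (e' k) = e k" using fun_cong[OF that, of k] by simp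
      show "e' k \<noteq> w" using that False by (auto simp: fun_eq_iff split: if_splits)
    qed
    then show ?thesis using False by (auto simp: wshift_def delta_def)
  qed
qed

lemma op_delta:
  assumes "e k = (a, b)"
  shows "Xop k (delta e) = delta (e(k := (Suc a, b)))"
    "Yop k (delta e) = (\<lambda>e'. inverse (q ^ a) * delta (e(k := (a, Suc b))) e')"
    "Aop k (delta e) = (\<lambda>e'. q ^ (2 * a + b) * delta e e')"
    "Dop k (delta e) = (\<lambda>e'. q ^ (a + 2 * b) * delta e e')"
    "Cop k (delta e) = (\<lambda>e'. q ^ (2 * a) * (q ^ 2 - 1) * qround q b * delta (e(k := (Suc a, b - 1))) e')"
proof -
  have upd: "e(k := (a, b)) = e" using assms by auto
  show "Xop k (delta e) = delta (e(k := (Suc a, b)))"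
    unfolding Xop_def by (subst wshift_delta[of _ "(Suc a, b)"]) (use assms in \<open>auto split: prod.splits if_splits\<close>)
  show "Yop k (delta e) = (\<lambda>e'. inverse (q ^ a) * delta (e(k := (a, Suc b))) e')"
    unfolding Yop_def by (subst wshift_delta[of _ "(a, Suc b)"]) (use assms in \<open>auto split: prod.splits if_splits\<close>)
  show "Aop k (delta e) = (\<lambda>e'. q ^ (2 * a + b) * delta e e')"
    unfolding Aop_def by (subst wshift_delta[of _ "(a, b)"]) (use assms upd in \<open>auto split: prod.splits if_splits\<close>)
  show "Dop k (delta e) = (\<lambda>e'. q ^ (a + 2 * b) * delta e e')"
    unfolding Dop_def by (subst wshift_delta[of _ "(a, b)"]) (use assms upd in \<open>auto split: prod.splits if_splits\<close>)
  show "Cop k (delta e) = (\<lambda>e'. q ^ (2 * a) * (q ^ 2 - 1) * qround q b * delta (e(k := (Suc a, b - 1))) e')"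
  proof (cases b)
    \<comment> \<open>No value of \<open>\<sigma>\<close> has second component 0, so the result
      vanishes; on the right the factor \<open>qround q 0\<close> neutralizes the truncated
      \<open>b - 1\<close>.\<close>
    case 0
    have "Cop k (delta e) e' = 0" for e'
      using 0 assms fun_upd_same[of e' k] by (auto simp: Cop_def wshift_def delta_def split: prod.splits)
    then show ?thesis using 0 by (simp add: fun_eq_iff)
  next
    case (Suc b')
    then show ?thesis
      unfolding Cop_def
      by (subst wshift_delta[of _ "(Suc a, b')"]) (use assms in \<open>auto split: prod.splits if_splits\<close>)
  qed
qed

lemma LY_delta:
  "(\<And>i. k \<le> i \<Longrightarrow> i < k + d \<Longrightarrow> e i = (0, 0)) \<Longrightarrow> e (k + d) = (a, b) \<Longrightarrow>
    LY d k (delta e) = (\<lambda>e'. inverse (q ^ a) * delta (e(k + d := (a, Suc b))) e')"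
proof (induction d arbitrary: k)
  case (Suc d)
  define e1 where "e1 = e(k + Suc d := (a, Suc b))"
  have "LY d (Suc k) (delta e) = (\<lambda>e'. inverse (q ^ a) * delta e1 e')"
    unfolding e1_def using Suc.IH[of "Suc k"] Suc.prems by (simp add: fun_upd_def)
  moreover have "e1 k = (0, 0)" using Suc.prems(1)[of k] by (simp add: e1_def)
  ultimately have "LY (Suc d) k (delta e) = (\<lambda>e'. inverse (q ^ a) * delta e1 e')"
    by (simp add: op_linear op_delta)
  then show ?case by (simp only: e1_def)
qed (simp add: op_delta)

text \<open>Crossing an empty block costs nothing: the weight of \<open>Aop\<close> is 1 and
  \<open>Cop\<close> contributes (0) = 0, so no y is created.\<close>

lemma LX_delta:
  "(\<And>i. k \<le> i \<Longrightarrow> i < k + d \<Longrightarrow> e i = (0, 0)) \<Longrightarrow> e (k + d) = (a, b) \<Longrightarrow>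
    LX d k (delta e) = delta (e(k + d := (Suc a, b)))"
proof (induction d arbitrary: k)
  case (Suc d)
  define e1 where "e1 = e(k + Suc d := (Suc a, b))"
  define e2 where "e2 = e(k + Suc d := (a, Suc b))"
  have "LX d (Suc k) (delta e) = delta e1"
    unfolding e1_def using Suc.IH[of "Suc k"] Suc.prems by (simp add: fun_upd_def)
  moreover have "LY d (Suc k) (delta e) = (\<lambda>e'. inverse (q ^ a) * delta e2 e')"
    unfolding e2_def using LY_delta[of "Suc k" d e a b] Suc.prems by (simp add: fun_upd_def)
  moreover have "e1 k = (0, 0)" "e2 k = (0, 0)" using Suc.prems(1)[of k] by (simp_all add: e1_def e2_def)
  ultimately have "LX (Suc d) k (delta e) = delta e1"
    by (simp add: op_linear op_delta)
  then show ?case by (simp only: e1_def)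
qed (simp add: op_delta)

lemma gact_delta:
  assumes "j \<ge> 1" "\<And>i. 1 \<le> i \<Longrightarrow> i < j \<Longrightarrow> e i = (0, 0)" "e j = (a, b)"
  shows "gact (X j) (delta e) = delta (e(j := (Suc a, b)))"
    "gact (Y j) (delta e) = (\<lambda>e'. inverse (q ^ a) * delta (e(j := (a, Suc b))) e')"
  using assms LX_delta[of 1 "j - 1" e a b] LY_delta[of 1 "j - 1" e a b] by simp_all

lemma wact_replicate_X:
  assumes "j \<ge> 1" "\<And>i. 1 \<le> i \<Longrightarrow> i < j \<Longrightarrow> e i = (0, 0)" "e j = (a, b)"
  shows "wact (replicate n (X j)) (delta e) = delta (e(j := (a + n, b)))"
proof (induction n)
  case 0
  show ?case using assms(3) by (simp add: fun_upd_idem)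
next
  case (Suc n)
  have "gact (X j) (delta (e(j := (a + n, b)))) = delta ((e(j := (a + n, b)))(j := (Suc (a + n), b)))"
    by (rule gact_delta) (use assms in auto)
  also have "(e(j := (a + n, b)))(j := (Suc (a + n), b)) = e(j := (a + Suc n, b))" by simp
  finally show ?case by (simp only: Suc replicate_Suc wact_simps)
qed

text \<open>Words act from the right, so y_j arrives before any x_j; with x_j-exponent 0 its weight
  is 1.\<close>

lemma wact_replicate_Y:
  assumes "j \<ge> 1" "\<And>i. 1 \<le> i \<Longrightarrow> i < j \<Longrightarrow> e i = (0, 0)" "e j = (0, b)"
  shows "wact (replicate n (Y j)) (delta e) = delta (e(j := (0, b + n)))"
proof (induction n)
  case 0
  show ?case using assms(3) by (simp add: fun_upd_idem)
next
  case (Suc n)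
  have "gact (Y j) (delta (e(j := (0, b + n))))
      = (\<lambda>e'. inverse (q ^ 0) * delta ((e(j := (0, b + n)))(j := (0, Suc (b + n)))) e')"
    by (rule gact_delta) (use assms in auto)
  also have "(e(j := (0, b + n)))(j := (0, Suc (b + n))) = e(j := (0, b + Suc n))" by simp
  finally show ?case by (simp add: Suc fun_upd_def del: gact.simps)
qed

definition vac :: coord where "vac = delta (\<lambda>_. (0, 0))"

definition tail_word :: "nat \<Rightarrow> nat \<Rightarrow> (nat \<Rightarrow> nat \<times> nat) \<Rightarrow> gen list" where
  "tail_word j p e = concat (map (\<lambda>a. replicate (fst (e a)) (X a) @ replicate (snd (e a)) (Y a)) [j..<Suc p])"

lemma tail_word_rec: "j \<le> p \<Longrightarrow> tail_word j p e
    = replicate (fst (e j)) (X j) @ replicate (snd (e j)) (Y j) @ tail_word (Suc j) p e"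
  by (simp add: tail_word_def upt_conv_Cons del: upt_Suc)

lemma wact_tail_word:
  assumes "1 \<le> j" "j \<le> Suc p"
  shows "wact (tail_word j p e) vac = delta (\<lambda>i. if j \<le> i \<and> i \<le> p then e i else (0, 0))"
  using assms(2,1)
proof (induction rule: inc_induct)
  case base
  have "(\<lambda>i. if Suc p \<le> i \<and> i \<le> p then e i else (0, 0)) = (\<lambda>_. (0, 0))" by (rule ext) auto
  then show ?case by (simp add: tail_word_def vac_def)
next
  case (step j)
  let ?t = "\<lambda>i. if Suc j \<le> i \<and> i \<le> p then e i else (0, 0)"
  obtain a b where ab: "e j = (a, b)" by fastforce
  have "wact (replicate b (Y j)) (delta ?t) = delta (?t(j := (0, b)))"
    using wact_replicate_Y[of j ?t 0 b] step by simp
  moreover have "wact (replicate a (X j)) (delta (?t(j := (0, b)))) = delta (?t(j := (a, b)))"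
    using wact_replicate_X[of j "?t(j := (0, b))" 0 b a] step by simp
  moreover have "?t(j := (a, b)) = (\<lambda>i. if j \<le> i \<and> i \<le> p then e i else (0, 0))"
    using step ab by (auto simp: fun_eq_iff)
  ultimately show ?case
    using step ab by (simp add: tail_word_rec wact_append)
qed

text \<open>Ordered monomials send the vacuum to distinct point masses, without scalars. This is
  their linear independence modulo the ideal.\<close>

lemma wact_pbw_word:
  assumes "e \<in> pbw_exps p"
  shows "wact (pbw_word p e) vac = delta e"
proof -
  have "(\<lambda>i. if 1 \<le> i \<and> i \<le> p then e i else (0, 0)) = e"
    using assms by (auto simp: pbw_exps_def)
  then show ?thesis using wact_tail_word[of 1 p e] by (simp add: pbw_word_def tail_word_def)
qed

section \<open>Normal forms and uniqueness of coordinates\<close>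

definition NF :: "fa \<Rightarrow> coord" where "NF h = act h vac"

lemma NF_pbw_sum:
  assumes "fcoord p c"
  shows "NF (pbw_sum p c) = c"
proof
  fix e
  have S: "finite {e. c e \<noteq> 0}" "\<And>e. c e \<noteq> 0 \<Longrightarrow> e \<in> pbw_exps p" using assms by (auto simp: fcoord_def)
  have "NF (pbw_sum p c) e = (\<Sum>e'\<in>{e. c e \<noteq> 0}. c e' * delta e' e)"
    unfolding NF_def pbw_sum_def using S by (subst act_sum[THEN conjunct2]) (auto simp: act_smult wact_pbw_word)
  also have "\<dots> = (\<Sum>e'\<in>{e. c e \<noteq> 0}. if e' = e then c e' else 0)"
    by (rule sum.cong) (auto simp: delta_def)
  also have "\<dots> = c e" using S(1) by simp
  finally show "NF (pbw_sum p c) e = c e" .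
qed

lemma NF_eqH:
  assumes "eqH q p a b" "fin a" "fin b"
  shows "NF a = NF b"
proof
  fix e
  have "act (fa_minus a b) vac = (\<lambda>e. 0)" using assms(1) act_ideal by (simp add: eqH_def)
  then have "(\<lambda>e. act a vac e - act b vac e) = (\<lambda>e. 0)" using assms by (simp add: act_minus)
  then show "NF a e = NF b e" by (simp add: NF_def fun_eq_iff)
qed

lemma NF_valid:
  assumes "valid p h"
  shows "fcoord p (NF h)" "eqH q p h (pbw_sum p (NF h))"
proof -
  obtain c where c: "fcoord p c" "eqH q p h (pbw_sum p c)"
    using spanned_valid[OF q0 assms] by (auto simp: spanned_def)
  have "NF h = c"
    using NF_eqH[OF c(2)] assms valid_pbw_sum valid_fin NF_pbw_sum[OF c(1)] by metis
  then show "fcoord p (NF h)" "eqH q p h (pbw_sum p (NF h))" using c by simp_all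
qed

lemma pbw_coords_eq_NF:
  assumes "valid p h"
  shows "pbw_coords q p h = NF h"
  unfolding pbw_coords_def
proof (rule the_equality)
  show "(\<forall>e. NF h e \<noteq> 0 \<longrightarrow> e \<in> pbw_exps p) \<and> finite {e. NF h e \<noteq> 0} \<and>
    eqH q p h (fa_sum (\<lambda>e. fa_smult (NF h e) (fa_word (pbw_word p e))) {e. NF h e \<noteq> 0})"
    using NF_valid[OF assms] by (simp add: fcoord_def pbw_sum_def)
next
  fix c assume "(\<forall>e. c e \<noteq> 0 \<longrightarrow> e \<in> pbw_exps p) \<and> finite {e. c e \<noteq> 0} \<and>
    eqH q p h (fa_sum (\<lambda>e. fa_smult (c e) (fa_word (pbw_word p e))) {e. c e \<noteq> 0})"
  then have c: "fcoord p c" "eqH q p h (pbw_sum p c)" by (simp_all add: fcoord_def pbw_sum_def)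
  show "c = NF h"
    using NF_eqH[OF c(2)] assms valid_pbw_sum valid_fin NF_pbw_sum[OF c(1)] by metis
qed

text \<open>The bridge used from here on: an equality in the algebra may be checked on coordinate
  functions.\<close>

lemma eqH_iff_NF:
  assumes "valid p a" "valid p b"
  shows "eqH q p a b \<longleftrightarrow> NF a = NF b"
proof
  assume "NF a = NF b"
  then have "NF (fa_minus a b) = (\<lambda>e. 0)"
    using assms valid_fin by (simp add: NF_def act_minus)
  then have "eqH q p (fa_minus a b) (pbw_sum p (\<lambda>e. 0))"
    using NF_valid(2)[OF valid_minus[OF assms]] by simp
  moreover have "fa_minus x (pbw_sum p (\<lambda>e. 0)) = x" for x
    by (simp add: pbw_sum_def fa_defs)
  ultimately show "eqH q p a b" by (simp add: eqH_def)
qed (use NF_eqH assms valid_fin in blast)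

section \<open>Polarization in coordinates\<close>

text \<open>The Leibniz rule along a word, applied to the vacuum: either the head is the replaced
  letter or a later one is.\<close>

primrec dact :: "nat \<Rightarrow> nat \<Rightarrow> gen list \<Rightarrow> coord" where
  "dact k l [] = (\<lambda>e. 0)"
| "dact k l (z # w) = (\<lambda>e. (if gen_idx z = k then gact (gprime l z) (wact w vac) e else 0) + gact z (dact k l w) e)"

lemma NF_delta_word: "NF (delta_word k l w) = dact k l w"
proof -
  have "NF (delta_word k l w) = (\<lambda>e. \<Sum>r\<in>{r. r < length w \<and> gen_idx (w ! r) = k}. wact (w[r := gprime l (w ! r)]) vac e)"
    unfolding NF_def delta_word_def by (subst act_sum[THEN conjunct2]) auto
  also have "\<dots> = (\<lambda>e. \<Sum>r<length w. if gen_idx (w ! r) = k then wact (w[r := gprime l (w ! r)]) vac e else 0)"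
    by (subst sum.inter_filter[symmetric]) simp_all
  also have "\<dots> = dact k l w"
  proof (induction w)
    case (Cons z w)
    have "gact z (\<lambda>e. \<Sum>r<length w. if gen_idx (w ! r) = k then wact (w[r := gprime l (w ! r)]) vac e else 0)
      = (\<lambda>e. \<Sum>r<length w. if gen_idx (w ! r) = k then gact z (wact (w[r := gprime l (w ! r)]) vac) e else 0)"
      by (subst linop_sum[OF linop_gact], intro ext sum.cong) (auto simp: linop_zero)
    then show ?case
      by (simp add: sum.lessThan_Suc_shift Cons[symmetric] del: sum.lessThan_Suc cong: if_cong)
  qed simp
  finally show ?thesis .
qed

lemma valid_delta_word:
  assumes "words_in p w" "l \<in> {1..p}"
  shows "valid p (delta_word k l w)"
  unfolding delta_word_def
proof (intro valid_sum valid_word)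
  fix r
  have "gen_idx (gprime l z) = l" for z by (cases z) simp_all
  then show "words_in p (w[r := gprime l (w ! r)])"
    using assms set_update_subset_insert[of w r "gprime l (w ! r)"] by (auto simp: words_in_def)
qed

definition M :: "(nat \<Rightarrow> nat \<times> nat) \<Rightarrow> nat \<Rightarrow> nat \<Rightarrow> nat \<Rightarrow> nat \<Rightarrow> coord" where
  "M e a b c d = delta (e(1 := (a, b), 2 := (c, d)))"

lemma gact_M:
  "gact (X (Suc 0)) (M e a b c d) = M e (Suc a) b c d"
  "gact (Y (Suc 0)) (M e a b c d) = (\<lambda>x. inverse (q ^ a) * M e a (Suc b) c d x)"
  "gact (X 2) (M e a b c d) = (\<lambda>x. q ^ (2 * a + b) * M e a b (Suc c) d x
      + q ^ (2 * a) * (q ^ 2 - 1) * qround q b * inverse (q ^ c) * M e (Suc a) (b - 1) c (Suc d) x)"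
  "gact (Y 2) (M e a b c d) = (\<lambda>x. q ^ (a + 2 * b) * inverse (q ^ c) * M e a b c (Suc d) x)"
proof -
  have at: "(e(1 := (a, b), 2 := (c, d))) 1 = (a, b)" "(e(1 := (a, b), 2 := (c, d))) 2 = (c, d)" for a b c d
    by simp_all
  have upd: "(e(1 := (a, b), 2 := (c, d)))(1 := v) = e(1 := v, 2 := (c, d))"
    "(e(1 := (a, b), 2 := (c, d)))(2 := v) = e(1 := (a, b), 2 := v)"
    for a b c d v by (auto simp: fun_eq_iff)
  note op1 = op_delta[of "e(1 := (a, b), 2 := (c, d))" 1 a b for a b c d, OF at(1), unfolded upd, folded M_def]
  note op2 = op_delta[of "e(1 := (a, b), 2 := (c, d))" 2 c d for a b c d, OF at(2), unfolded upd, folded M_def]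
  have two: "(2::nat) - 1 = Suc 0" "Suc (Suc 0) = (2::nat)" "Suc 0 - 1 = 0" "Suc 1 = 2" by simp_all
  show "gact (X (Suc 0)) (M e a b c d) = M e (Suc a) b c d"
    by (simp only: gact.simps two LX.simps op1)
  show "gact (Y (Suc 0)) (M e a b c d) = (\<lambda>x. inverse (q ^ a) * M e a (Suc b) c d x)"
    by (simp only: gact.simps two LY.simps op1)
  show "gact (X 2) (M e a b c d) = (\<lambda>x. q ^ (2 * a + b) * M e a b (Suc c) d x
      + q ^ (2 * a) * (q ^ 2 - 1) * qround q b * inverse (q ^ c) * M e (Suc a) (b - 1) c (Suc d) x)"
    by (simp only: gact.simps two LX.simps LY.simps op1 op2 op_linear) (simp only: mult_ac)
  show "gact (Y 2) (M e a b c d) = (\<lambda>x. q ^ (a + 2 * b) * inverse (q ^ c) * M e a b c (Suc d) x)"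
    by (simp only: gact.simps two LX.simps LY.simps op1 op2 op_linear) (simp only: mult_ac)
qed

lemmas gact_linear = linop_add[OF linop_gact] linop_smult[OF linop_gact]

lemma dact_no_letter: "k \<notin> gen_idx ` set w \<Longrightarrow> dact k l w = (\<lambda>e. 0)"
  by (induction w) (auto simp: linop_zero)

lemma wact_block_words:
  assumes "wact w vac = M e 0 0 0 0"
  shows "wact (replicate d (Y 2) @ w) vac = M e 0 0 0 d"
    "wact (replicate c (X 2) @ replicate d (Y 2) @ w) vac = M e 0 0 c d"
    "wact (replicate b (Y (Suc 0)) @ replicate c (X 2) @ replicate d (Y 2) @ w) vac = M e 0 b c d"
proof -
  show 1: "wact (replicate d (Y 2) @ w) vac = M e 0 0 0 d"
    by (induction d) (use assms in \<open>simp_all add: gact_M del: gact.simps\<close>)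
  show 2: "wact (replicate c (X 2) @ replicate d (Y 2) @ w) vac = M e 0 0 c d"
    by (induction c) (use 1 in \<open>simp_all add: gact_M del: gact.simps\<close>)
  show "wact (replicate b (Y (Suc 0)) @ replicate c (X 2) @ replicate d (Y 2) @ w) vac = M e 0 b c d"
    by (induction b) (use 2 in \<open>simp_all add: gact_M del: gact.simps\<close>)
qed

lemma wact_block_word:
  assumes "wact w vac = M e 0 0 0 0"
  shows "wact (replicate a (X (Suc 0)) @ replicate b (Y (Suc 0)) @ replicate c (X 2) @ replicate d (Y 2) @ w) vac = M e a b c d"
  by (induction a) (use wact_block_words[OF assms] in \<open>simp_all add: gact_M del: gact.simps\<close>)

text \<open>The word is built from right to left. Each new x_1 or y_1 adds the term in which it is
  replaced, and the replacement is moved right to its ordered place; the weights sum geometrically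
  to (a) and (b).\<close>

lemma dact_12:
  assumes w: "wact w vac = M e 0 0 0 0" and no: "Suc 0 \<notin> gen_idx ` set w"
  shows "dact (Suc 0) 2 (replicate a (X (Suc 0)) @ replicate b (Y (Suc 0)) @ replicate c (X 2) @ replicate d (Y 2) @ w)
    = (\<lambda>x. qround q a * q ^ b * M e (a - 1) b (Suc c) d x
        + q ^ (2 * a) * inverse (q ^ c) * qround q b * M e a (b - 1) c (Suc d) x)"
proof -
  let ?w2 = "replicate c (X 2) @ replicate d (Y 2) @ w"
  have 0: "dact (Suc 0) 2 ?w2 = (\<lambda>x. 0)"
    by (rule dact_no_letter) (use no in auto)
  have 1: "dact (Suc 0) 2 (replicate b (Y (Suc 0)) @ ?w2) = (\<lambda>x. inverse (q ^ c) * qround q b * M e 0 (b - 1) c (Suc d) x)" for b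
  proof (induction b)
    case 0
    then show ?case using \<open>dact (Suc 0) 2 ?w2 = (\<lambda>x. 0)\<close> by simp
  next
    case (Suc b)
    have "dact (Suc 0) 2 (replicate (Suc b) (Y (Suc 0)) @ ?w2) = (\<lambda>x. gact (Y 2) (M e 0 b c d) x
        + gact (Y (Suc 0)) (\<lambda>x. inverse (q ^ c) * qround q b * M e 0 (b - 1) c (Suc d) x) x)"
      using wact_block_words[OF w] by (simp add: Suc del: gact.simps)
    also have "\<dots> = (\<lambda>x. inverse (q ^ c) * qround q (Suc b) * M e 0 b c (Suc d) x)"
      by (cases b) (simp_all add: gact_M gact_linear linop_zero qround_Suc algebra_simps del: gact.simps)
    finally show ?case by simp
  qed
  show ?thesis
  proof (induction a)
    case 0
    show ?case using 1 by simp
  next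
    case (Suc a)
    let ?f = "\<lambda>x. qround q a * q ^ b * M e (a - 1) b (Suc c) d x
        + q ^ (2 * a) * inverse (q ^ c) * qround q b * M e a (b - 1) c (Suc d) x"
    have "dact (Suc 0) 2 (replicate (Suc a) (X (Suc 0)) @ replicate b (Y (Suc 0)) @ ?w2)
        = (\<lambda>x. gact (X 2) (M e a b c d) x + gact (X (Suc 0)) ?f x)"
      using wact_block_word[OF w] by (simp add: Suc del: gact.simps)
    also have "\<dots> = (\<lambda>x. qround q (Suc a) * q ^ b * M e a b (Suc c) d x
        + q ^ (2 * Suc a) * inverse (q ^ c) * qround q b * M e (Suc a) (b - 1) c (Suc d) x)"
      by (cases a) (simp_all add: gact_M gact_linear qround_Suc power_add algebra_simps power2_eq_square
          del: gact.simps)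
    finally show ?case by simp
  qed
qed

lemma dact_21:
  assumes w: "wact w vac = M e 0 0 0 0" and no: "2 \<notin> gen_idx ` set w"
  shows "dact 2 (Suc 0) (replicate a (X (Suc 0)) @ replicate b (Y (Suc 0)) @ replicate c (X 2) @ replicate d (Y 2) @ w)
    = (\<lambda>x. qround q c * q ^ (2 * d) * inverse (q ^ b) * M e (Suc a) b (c - 1) d x
        + qround q d * q ^ c * M e a (Suc b) c (d - 1) x)"
proof -
  have 0: "dact 2 (Suc 0) w = (\<lambda>x. 0)"
    by (rule dact_no_letter) (use no in auto)
  have 1: "dact 2 (Suc 0) (replicate d (Y 2) @ w) = (\<lambda>x. qround q d * M e 0 1 0 (d - 1) x)" for d
  proof (induction d)
    case 0
    then show ?case using \<open>dact 2 (Suc 0) w = (\<lambda>x. 0)\<close> by simp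
  next
    case (Suc d)
    have "dact 2 (Suc 0) (replicate (Suc d) (Y 2) @ w) = (\<lambda>x. gact (Y (Suc 0)) (M e 0 0 0 d) x
        + gact (Y 2) (\<lambda>x. qround q d * M e 0 1 0 (d - 1) x) x)"
      using wact_block_words[OF w] by (simp add: Suc del: gact.simps)
    also have "\<dots> = (\<lambda>x. qround q (Suc d) * M e 0 1 0 d x)"
    proof (cases d)
      case (Suc d')
      \<comment> \<open>The new letter contributes 1, and the earlier y_1 passes one more y_2 at the
        cost q^2.\<close>
      have "qround q (Suc d) = 1 + q ^ 2 * qround q d"
        using qround_eq[of d] by (simp add: qround_Suc algebra_simps)
      then show ?thesis using Suc
        by (simp add: gact_M gact_linear algebra_simps power2_eq_square del: gact.simps)
    qed (simp add: gact_M gact_linear qround_Suc linop_zero del: gact.simps)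
    finally show ?case by simp
  qed
  have 2: "dact 2 (Suc 0) (replicate c (X 2) @ replicate d (Y 2) @ w)
      = (\<lambda>x. qround q c * q ^ (2 * d) * M e 1 0 (c - 1) d x + qround q d * q ^ c * M e 0 1 c (d - 1) x)" for c
  proof (induction c)
    case 0
    then show ?case using 1 by simp
  next
    case (Suc c)
    let ?f = "\<lambda>x. qround q c * q ^ (2 * d) * M e 1 0 (c - 1) d x + qround q d * q ^ c * M e 0 1 c (d - 1) x"
    have cancel: "q ^ n * (inverse (q ^ n) * x) = x" "q * (inverse q * x) = x" for n x
      using q0 by (simp_all add: mult.assoc[symmetric])
    have "dact 2 (Suc 0) (replicate (Suc c) (X 2) @ replicate d (Y 2) @ w)
        = (\<lambda>x. gact (X (Suc 0)) (M e 0 0 c d) x + gact (X 2) ?f x)"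
      using wact_block_words[OF w] by (simp add: Suc del: gact.simps)
    also have "\<dots> = (\<lambda>x. (1 + q ^ 2 * qround q c * q ^ (2 * d) + (q ^ 2 - 1) * qround q d) * M e 1 0 c d x
        + qround q d * q ^ Suc c * M e 0 1 (Suc c) (d - 1) x)"
      by (cases c; cases d) (simp_all add: gact_M gact_linear linop_zero qround_Suc q0 cancel algebra_simps power2_eq_square
          del: gact.simps)
    \<comment> \<open>The third summand comes from x_2 crossing y_1, which also produces x_1 y_2. As
      it equals q^(2d) - 1, it cancels the 1 and completes the factor (c+1).\<close>
    also have "1 + q ^ 2 * qround q c * q ^ (2 * d) + (q ^ 2 - 1) * qround q d = qround q (Suc c) * q ^ (2 * d)"
    proof -
      have "qround q (Suc c) = 1 + q ^ 2 * qround q c"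
        using qround_eq[of c] by (simp add: qround_Suc algebra_simps)
      then show ?thesis unfolding qround_eq by (simp add: algebra_simps)
    qed
    finally show ?case by simp
  qed
  have 3: "dact 2 (Suc 0) (replicate b (Y (Suc 0)) @ replicate c (X 2) @ replicate d (Y 2) @ w)
    = (\<lambda>x. qround q c * q ^ (2 * d) * inverse (q ^ b) * M e 1 b (c - 1) d x
        + qround q d * q ^ c * M e 0 (Suc b) c (d - 1) x)"
  proof (induction b)
    case 0
    then show ?case using 2 by simp
  next
    case (Suc b)
    then show ?case
      by (simp add: gact_M gact_linear algebra_simps del: gact.simps)
  qed
  show ?thesis
  proof (induction a)
    case 0
    then show ?case using 3 by simp
  next
    case (Suc a)
    then show ?case
      by (simp add: gact_M gact_linear del: gact.simps)
  qed
qed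


section \<open>Relations between the polarization operators\<close>

text \<open>In the operators below \<open>g a b c d\<close> stands for the coefficient of a monomial starting with
  \<open>x\<^sub>1\<^sup>a y\<^sub>1\<^sup>b x\<^sub>2\<^sup>c y\<^sub>2\<^sup>d\<close>. \<open>Dp\<close> is \<open>\<Delta>\<^sub>1\<^sub>2\<close>, \<open>Dm\<close> is \<open>\<Delta>\<^sub>2\<^sub>1\<close>,
  \<open>Br\<close> is left multiplication by \<open>(12)\<close>, and \<open>Om\<close> is \<open>\<Omega>\<^sub>1\<^sub>2\<close> up to the scalar
  \<open>q (m) (n)\<close> in bidegree \<open>(m, n)\<close>.\<close>
definition Dp :: "(nat \<Rightarrow> nat \<Rightarrow> nat \<Rightarrow> nat \<Rightarrow> complex) \<Rightarrow> nat \<Rightarrow> nat \<Rightarrow> nat \<Rightarrow> nat \<Rightarrow> complex" where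
  "Dp g a b c d = (if c = 0 then 0 else qround q (Suc a) * q ^ b * g (Suc a) b (c - 1) d)
     + (if d = 0 then 0 else q ^ (2 * a) * inverse (q ^ c) * qround q (Suc b) * g a (Suc b) c (d - 1))"

definition Dm :: "(nat \<Rightarrow> nat \<Rightarrow> nat \<Rightarrow> nat \<Rightarrow> complex) \<Rightarrow> nat \<Rightarrow> nat \<Rightarrow> nat \<Rightarrow> nat \<Rightarrow> complex" where
  "Dm g a b c d = (if a = 0 then 0 else qround q (Suc c) * q ^ (2 * d) * inverse (q ^ b) * g (a - 1) b (Suc c) d)
     + (if b = 0 then 0 else qround q (Suc d) * q ^ c * g a (b - 1) c (Suc d))"

definition Br :: "(nat \<Rightarrow> nat \<Rightarrow> nat \<Rightarrow> nat \<Rightarrow> complex) \<Rightarrow> nat \<Rightarrow> nat \<Rightarrow> nat \<Rightarrow> nat \<Rightarrow> complex" where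
  "Br g a b c d = (if a = 0 \<or> d = 0 then 0 else inverse s * q ^ (a - 1) * inverse (q ^ c) * g (a - 1) b c (d - 1))
     - (if b = 0 \<or> c = 0 then 0 else s * q ^ (a + b - 1) * g a (b - 1) (c - 1) d)"

definition Om :: "(nat \<Rightarrow> nat \<Rightarrow> nat \<Rightarrow> nat \<Rightarrow> complex) \<Rightarrow> nat \<Rightarrow> nat \<Rightarrow> nat \<Rightarrow> nat \<Rightarrow> complex" where
  "Om g a b c d = inverse s * q * q ^ c * inverse (q ^ a) * qround q (Suc a) * qround q (Suc d) * g (Suc a) b c (Suc d)
     - s * q * q ^ a * q ^ (2 * d) * inverse (q ^ b) * qround q (Suc b) * qround q (Suc c) * g a (Suc b) (Suc c) d"

lemmas D_defs = Dp_def Dm_def Br_def Om_def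

text \<open>Gives both terms of \<open>Br\<close> and of \<open>Om\<close> the same factor s, so
  that s occurs only as a common factor or through its square.\<close>

lemma inverse_s: "inverse s = s / q"
  unfolding s2[symmetric] using s0 by (simp add: power2_eq_square inverse_eq_divide)

text \<open>Hides the denominator q^2 - 1 in one constant, so that identities between the integers
  (m) become polynomial in powers of q.\<close>

lemma qround_factor:
  obtains k where "\<And>m. qround q m = (q ^ (2 * m) - 1) * k"
  using that[of "inverse (q ^ 2 - 1)"] by (simp add: qround_def divide_inverse)

lemma Dm_Br: "Dm (Br g) a b c d = Br (Dm g) a b c d"
proof -
  obtain k where k: "\<And>m. qround q m = (q ^ (2 * m) - 1) * k" using qround_factor by blast
  show ?thesis
    unfolding D_defs inverse_s
    \<comment> \<open>Both operators lower the exponents of block 1, hence the separate cases 0, 1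
      and at least 2.\<close>
    by (cases a; cases "a - 1"; cases b; cases "b - 1"; cases c; cases d)
      (simp_all add: k q0 s0 field_simps power_add power_mult power2_eq_square)
qed

lemma Om_Dp: "Om (Dp g) a b c d = q ^ 2 * Dp (Om g) a b c d"
proof -
  obtain k where k: "\<And>m. qround q m = (q ^ (2 * m) - 1) * k" using qround_factor by blast
  show ?thesis
    unfolding D_defs inverse_s
    by (cases c; cases d)
      (simp_all add: k q0 s0 field_simps power_add power_mult power2_eq_square)
qed

text \<open>The quantum Capelli identity: polarizing forth and back differs from a scalar by a
  multiple of (12).\<close>

lemma Br_Om: "Br (Om g) a b c d = qround q (a + b) * qround q (Suc (c + d)) * g a b c d - Dm (Dp g) a b c d"
proof -
  obtain k where k: "\<And>m. qround q m = (q ^ (2 * m) - 1) * k" using qround_factor by blast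
  have s: "s * (s * x) = q * x" for x using s2 by (simp add: power2_eq_square mult.assoc[symmetric])
  show ?thesis
    unfolding D_defs inverse_s
    by (cases a; cases b; cases c; cases d)
      (simp_all add: k q0 s0 s field_simps power_add power_mult power2_eq_square)
qed


section \<open>Transfer to functions of all exponents\<close>

definition lift :: "((nat \<Rightarrow> nat \<Rightarrow> nat \<Rightarrow> nat \<Rightarrow> complex) \<Rightarrow> nat \<Rightarrow> nat \<Rightarrow> nat \<Rightarrow> nat \<Rightarrow> complex) \<Rightarrow> coord \<Rightarrow> coord" where
  "lift T c = (\<lambda>e. T (\<lambda>a b a' b'. c (e(1 := (a, b), 2 := (a', b'))))
      (fst (e 1)) (snd (e 1)) (fst (e 2)) (snd (e 2)))"

lemma lift_lift: "lift T (lift T' c) = lift (\<lambda>g. T (T' g)) c"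
proof -
  have "(e(1 := x, 2 := y))(1 := z, 2 := w) = e(1 := z, 2 := w)"
    for e :: "nat \<Rightarrow> nat \<times> nat" and x y z w by (auto simp: fun_eq_iff)
  then show ?thesis by (simp add: lift_def)
qed

lemma linop_lift [simp]: "linop (lift Dp)" "linop (lift Dm)" "linop (lift Br)" "linop (lift Om)"
  by (auto simp: linop_def lift_def D_defs fun_eq_iff algebra_simps)

lemmas lift_linear = linop_lift[THEN linop_sum] linop_lift[THEN linop_smult] linop_lift[THEN linop_zero]

lemma lift_Dm_Br: "lift Dm (lift Br c) = lift Br (lift Dm c)"
  unfolding lift_lift by (simp add: lift_def Dm_Br)

lemma lift_Om_Dp: "lift Om (lift Dp c) = (\<lambda>e. q ^ 2 * lift Dp (lift Om c) e)"
  unfolding lift_lift by (simp add: lift_def Om_Dp)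

text \<open>This one identity yields both the existence part of the \<open>\<Omega>\<close>-process and the induction step
  of the expansion.\<close>
lemma lift_Br_Om: "lift Br (lift Om c) e
    = qround q (pbw_deg e 1) * qround q (Suc (pbw_deg e 2)) * c e - lift Dm (lift Dp c) e"
proof -
  have "e(1 := (fst (e 1), snd (e 1)), 2 := (fst (e 2), snd (e 2))) = e" by simp
  then show ?thesis unfolding lift_lift by (simp only: lift_def Br_Om pbw_deg_def)
qed

definition bihom :: "nat \<Rightarrow> nat \<Rightarrow> coord \<Rightarrow> bool" where
  "bihom m n c \<longleftrightarrow> (\<forall>e. c e \<noteq> 0 \<longrightarrow> pbw_deg e 1 = m \<and> pbw_deg e 2 = n)"

lemma bihom_D: "bihom m n c \<Longrightarrow> c (e(1 := (a, b), 2 := (a', b'))) \<noteq> 0 \<Longrightarrow> a + b = m \<and> a' + b' = n"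
  by (auto simp: bihom_def pbw_deg_def dest: spec[of _ "e(1 := (a, b), 2 := (a', b'))"])

text \<open>For m = 0 the truncated \<open>m - 1\<close> does no harm, since there is no source
  monomial and \<open>lift Dp c\<close> is zero. The next two lemmas treat truncation in the same
  way.\<close>

lemma bihom_Dp: "bihom m n c \<Longrightarrow> bihom (m - 1) (Suc n) (lift Dp c)"
  unfolding bihom_def[of "m - 1"]
proof (intro allI impI)
  fix e assume c: "bihom m n c" and nz: "lift Dp c e \<noteq> 0"
  let ?u = "e(1 := (Suc (fst (e 1)), snd (e 1)), 2 := (fst (e 2) - 1, snd (e 2)))"
  let ?v = "e(1 := (fst (e 1), Suc (snd (e 1))), 2 := (fst (e 2), snd (e 2) - 1))"
  have "fst (e 2) \<noteq> 0 \<and> c ?u \<noteq> 0 \<or> snd (e 2) \<noteq> 0 \<and> c ?v \<noteq> 0"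
  proof (rule ccontr)
    assume "\<not> ?thesis"
    then have "lift Dp c e = 0" by (auto simp: lift_def Dp_def)
    then show False using nz by simp
  qed
  then show "pbw_deg e 1 = m - 1 \<and> pbw_deg e 2 = Suc n"
    by (elim disjE conjE) (drule bihom_D[OF c], simp add: pbw_deg_def, linarith)+
qed

lemma bihom_Dm: "bihom m n c \<Longrightarrow> bihom (Suc m) (n - 1) (lift Dm c)"
  unfolding bihom_def[of "Suc m"]
proof (intro allI impI)
  fix e assume c: "bihom m n c" and nz: "lift Dm c e \<noteq> 0"
  let ?u = "e(1 := (fst (e 1) - 1, snd (e 1)), 2 := (Suc (fst (e 2)), snd (e 2)))"
  let ?v = "e(1 := (fst (e 1), snd (e 1) - 1), 2 := (fst (e 2), Suc (snd (e 2))))"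
  have "fst (e 1) \<noteq> 0 \<and> c ?u \<noteq> 0 \<or> snd (e 1) \<noteq> 0 \<and> c ?v \<noteq> 0"
  proof (rule ccontr)
    assume "\<not> ?thesis"
    then have "lift Dm c e = 0" by (auto simp: lift_def Dm_def)
    then show False using nz by simp
  qed
  then show "pbw_deg e 1 = Suc m \<and> pbw_deg e 2 = n - 1"
    by (elim disjE conjE) (drule bihom_D[OF c], simp add: pbw_deg_def, linarith)+
qed

lemma bihom_Om: "bihom m n c \<Longrightarrow> bihom (m - 1) (n - 1) (lift Om c)"
  unfolding bihom_def[of "m - 1"]
proof (intro allI impI)
  fix e assume c: "bihom m n c" and nz: "lift Om c e \<noteq> 0"
  let ?u = "e(1 := (Suc (fst (e 1)), snd (e 1)), 2 := (fst (e 2), Suc (snd (e 2))))"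
  let ?v = "e(1 := (fst (e 1), Suc (snd (e 1))), 2 := (Suc (fst (e 2)), snd (e 2)))"
  have "c ?u \<noteq> 0 \<or> c ?v \<noteq> 0"
  proof (rule ccontr)
    assume "\<not> ?thesis"
    then have "lift Om c e = 0" by (simp add: lift_def Om_def)
    then show False using nz by simp
  qed
  then show "pbw_deg e 1 = m - 1 \<and> pbw_deg e 2 = n - 1"
    by (elim disjE) (drule bihom_D[OF c], simp add: pbw_deg_def, linarith)+
qed

lemma Om_eq_0:
  assumes "bihom m n c" "m = 0 \<or> n = 0"
  shows "lift Om c = (\<lambda>e. 0)"
proof -
  have "c (e(1 := (Suc a, b), 2 := (a', Suc b'))) = 0" "c (e(1 := (a, Suc b), 2 := (Suc a', b'))) = 0" for e a b a' b'
    using bihom_D[OF assms(1)] assms(2) by (metis add_is_0 nat.simps(3))+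
  then show ?thesis by (simp add: lift_def Om_def)
qed

lemma bihom_smult: "bihom m n c \<Longrightarrow> bihom m n (\<lambda>e. k * c e)"
  by (auto simp: bihom_def)

lemma linop_funpow: "linop T \<Longrightarrow> linop (T ^^ k)"
proof (induction k)
  case 0
  then show ?case by (simp add: linop_def)
next
  case (Suc k)
  have "T ^^ Suc k = (\<lambda>c. T ((T ^^ k) c))" by (rule ext) simp
  then show ?case using Suc by (simp add: linop_comp)
qed

lemma Dm_Br_pow: "lift Dm ((lift Br ^^ k) c) = (lift Br ^^ k) (lift Dm c)"
  by (induction k) (simp_all add: lift_Dm_Br)

lemma Om_pow_Dp: "(lift Om ^^ k) (lift Dp c) = (\<lambda>e. q ^ (2 * k) * lift Dp ((lift Om ^^ k) c) e)"
proof (induction k)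
  case (Suc k)
  then show ?case
    by (simp add: lift_linear lift_Om_Dp mult_ac power2_eq_square)
qed simp

text \<open>Each \<open>Om\<close> lowers both degrees by one, so the expansion stops at the smaller
  degree.\<close>

lemma Om_pow_eq_0: "bihom m n c \<Longrightarrow> k > min m n \<Longrightarrow> (lift Om ^^ k) c = (\<lambda>e. 0)"
proof (induction k arbitrary: m n c)
  case (Suc k)
  show ?case
  proof (cases "m = 0 \<or> n = 0")
    case True
    then have "lift Om c = (\<lambda>e. 0)" using Om_eq_0 Suc.prems by blast
    then show ?thesis by (simp add: funpow_Suc_right linop_zero linop_funpow del: funpow.simps)
  next
    case False
    then have "(lift Om ^^ k) (lift Om c) = (\<lambda>e. 0)"
      using Suc.prems by (intro Suc.IH[OF bihom_Om]) auto
    then show ?thesis by (simp add: funpow_Suc_right del: funpow.simps)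
  qed
qed simp

section \<open>Coefficients and the expansion in coordinates\<close>

definition rfact :: "nat \<Rightarrow> complex" where "rfact n = (\<Prod>i=1..n. qround q i)"

lemma rfact_0 [simp]: "rfact 0 = 1"
  by (simp add: rfact_def)

lemma rfact_Suc: "rfact (Suc n) = qround q (Suc n) * rfact n"
  by (simp add: rfact_def mult.commute)

lemma rfact_neq_0 [simp]: "rfact n \<noteq> 0"
  by (auto simp: rfact_def qround_neq_0)

text \<open>The coefficient of the theorem once the normalizations of \<open>P\<^sub>1\<^sub>2\<close>, \<open>P\<^sub>2\<^sub>1\<close> and \<open>\<Omega>\<^sub>1\<^sub>2\<close> are
  moved into it; all powers of \<open>q\<close> cancel, so that only the integers \<open>(m)\<close> remain.\<close>
definition gcoef :: "nat \<Rightarrow> nat \<Rightarrow> nat \<Rightarrow> complex" where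
  "gcoef m n k = qround q (Suc (m + n - 2 * k)) * rfact (n - k) / (rfact k * rfact (m - k) * rfact (Suc (m + n - k)))"

text \<open>With m + 1 = k + i and n = k + j, each coefficient is a product of integers times the
  same fraction; dividing it out leaves \<open>key\<close>. The excluded branches agree because (i)
  = 0 or (k) = 0 there.\<close>

lemma gcoef_rec:
  assumes "k \<le> Suc m" "k \<le> n"
  shows "qround q (Suc m) * qround q (Suc n) * gcoef (Suc m) n k
    = (if k \<le> m then q ^ (2 * k) * gcoef m (Suc n) k else 0) + (if k = 0 then 0 else gcoef m (n - 1) (k - 1))"
proof -
  obtain i where i: "Suc m = k + i" using assms(1) le_Suc_ex by blast
  obtain j where j: "n = k + j" using assms(2) le_Suc_ex by blast
  obtain K where K: "\<And>m. qround q m = (q ^ (2 * m) - 1) * K" using qround_factor by blast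
  have key: "qround q (k + i) * qround q (Suc (k + j))
      = q ^ (2 * k) * qround q (Suc j) * qround q i + qround q k * qround q (Suc (k + i + j))"
    by (simp add: K algebra_simps power_add power_mult power2_eq_square)
  have gc: "gcoef (Suc m) n k = qround q (Suc (i + j)) * rfact j / (rfact k * rfact i * rfact (Suc (k + i + j)))"
  proof -
    have idx: "Suc m + n - 2 * k = i + j" "n - k = j" "Suc m - k = i" "Suc m + n - k = k + i + j"
      unfolding i j by simp_all
    show ?thesis unfolding gcoef_def idx by (rule refl)
  qed
  have 1: "(if k \<le> m then q ^ (2 * k) * gcoef m (Suc n) k else 0)
      = q ^ (2 * k) * qround q (Suc j) * qround q i * (qround q (Suc (i + j)) * rfact j / (rfact k * rfact i * rfact (Suc (k + i + j))))"
  proof (cases i)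
    case 0
    then show ?thesis using i by auto
  next
    case (Suc i')
    then have m: "m = k + i'" using i by simp
    have nz: "qround q i \<noteq> 0" using Suc by (simp add: qround_neq_0)
    have fact: "rfact i = qround q i * rfact i'" "rfact (Suc j) = qround q (Suc j) * rfact j"
      unfolding Suc by (rule rfact_Suc)+
    have idx: "m + Suc n - 2 * k = i + j" "Suc n - k = Suc j" "m - k = i'" "m + Suc n - k = k + i + j"
      unfolding m j using Suc by simp_all
    have "gcoef m (Suc n) k = qround q (Suc (i + j)) * rfact (Suc j) / (rfact k * rfact i' * rfact (Suc (k + i + j)))"
      unfolding gcoef_def idx by (rule refl)
    note g = this
    have cancel: "y * (x * (B * z) / (r * t * u)) = y * B * A * (x * z / (r * (A * t) * u))" if "A \<noteq> 0"
      for x y z r t u A B :: complex using that by (simp add: mult_ac)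
    have "(if k \<le> m then q ^ (2 * k) * gcoef m (Suc n) k else 0) = q ^ (2 * k) * gcoef m (Suc n) k" using m by simp
    then show ?thesis unfolding g fact cancel[OF nz] .
  qed
  have 2: "(if k = 0 then 0 else gcoef m (n - 1) (k - 1))
      = qround q k * qround q (Suc (k + i + j)) * (qround q (Suc (i + j)) * rfact j / (rfact k * rfact i * rfact (Suc (k + i + j))))"
  proof (cases k)
    case (Suc k')
    then have m: "m = k' + i" using i by simp
    have nz: "qround q k \<noteq> 0" "qround q (Suc (k + i + j)) \<noteq> 0" using Suc by (simp_all add: qround_neq_0)
    have fact: "rfact k = qround q k * rfact k'" "rfact (Suc (k + i + j)) = qround q (Suc (k + i + j)) * rfact (k + i + j)"
      unfolding Suc by (rule rfact_Suc)+
    have idx: "m + (n - 1) - 2 * (k - 1) = i + j" "n - 1 - (k - 1) = j" "m - (k - 1) = i"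
        "Suc (m + (n - 1) - (k - 1)) = k + i + j" "k - 1 = k'"
      unfolding m j using Suc by simp_all
    have "gcoef m (n - 1) (k - 1) = qround q (Suc (i + j)) * rfact j / (rfact k' * rfact i * rfact (k + i + j))"
      unfolding gcoef_def idx(1,2,3,4) unfolding idx(5) by (rule refl)
    note g = this
    have cancel: "x / (r * t * u) = A * B * (x / ((A * r) * t * (B * u)))" if "A \<noteq> 0" "B \<noteq> 0"
      for x r t u A B :: complex using that by simp
    have "(if k = 0 then 0 else gcoef m (n - 1) (k - 1)) = gcoef m (n - 1) (k - 1)" using Suc by simp
    also note g
    also note cancel[OF nz]
    finally show ?thesis by (simp only: fact)
  qed simp
  show ?thesis
    unfolding 1 2 gc unfolding i j key by (simp only: distrib_right)
qed

text \<open>The k-th term of the expansion with all normalizations removed.\<close>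

definition gterm :: "nat \<Rightarrow> nat \<Rightarrow> coord \<Rightarrow> coord" where
  "gterm m k c = (lift Br ^^ k) ((lift Dm ^^ (m - k)) ((lift Dp ^^ (m - k)) ((lift Om ^^ k) c)))"

text \<open>The outer \<open>Dm\<close> passes the powers of \<open>Br\<close> freely and the inner
  \<open>Dp\<close> leaves the k powers of \<open>Om\<close> at the cost q^(2k); each then raises
  its own power by one.\<close>

lemma Dm_gterm_Dp:
  assumes "k \<le> m"
  shows "lift Dm (gterm m k (lift Dp c)) = (\<lambda>e. q ^ (2 * k) * gterm (Suc m) k c e)"
proof -
  have "Suc m - k = Suc (m - k)" using assms by simp
  then show ?thesis
    by (simp add: gterm_def Om_pow_Dp linop_smult[OF linop_funpow[OF linop_lift(1)]] linop_smult[OF linop_funpow[OF linop_lift(2)]]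
        linop_smult[OF linop_funpow[OF linop_lift(3)]] lift_linear Dm_Br_pow funpow_swap1)
qed

lemma Br_gterm_Om: "lift Br (gterm m k (lift Om c)) = gterm (Suc m) (Suc k) c"
  by (simp add: gterm_def funpow_swap1)

theorem gordan_capelli:
  assumes "bihom m n c"
  shows "c = (\<lambda>e. \<Sum>k=0..min m n. gcoef m n k * gterm m k c e)"
proof -
  \<comment> \<open>In the induction the sum runs to m, a range independent of n, which changes
    between the two uses of the hypothesis. Terms beyond n vanish.\<close>
  have "c = (\<lambda>e. \<Sum>k\<le>m. gcoef m n k * gterm m k c e)"
    using assms
  proof (induction m arbitrary: n c)
    case 0
    show ?case by (simp add: gcoef_def gterm_def rfact_Suc qround_neq_0)
  next
    case (Suc m)
    have zero: "gterm (Suc m) k c = (\<lambda>e. 0)" if "k > n" for k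
      using Om_pow_eq_0[OF Suc.prems, of k] that by (simp add: gterm_def linop_zero linop_funpow)
    have IH1: "lift Dp c = (\<lambda>e. \<Sum>k\<le>m. gcoef m (Suc n) k * gterm m k (lift Dp c) e)"
      using Suc.IH[OF bihom_Dp[OF Suc.prems, simplified]] .
    have IH2: "lift Om c = (\<lambda>e. \<Sum>k\<le>m. gcoef m (n - 1) k * gterm m k (lift Om c) e)"
      by (rule Suc.IH) (use bihom_Om[OF Suc.prems] in simp)
    have "lift Dm (lift Dp c) = (\<lambda>e. \<Sum>k\<le>m. gcoef m (Suc n) k * lift Dm (gterm m k (lift Dp c)) e)"
      by (subst IH1) (simp add: lift_linear)
    also have "\<dots> = (\<lambda>e. \<Sum>k\<le>Suc m. (if k \<le> m then q ^ (2 * k) * gcoef m (Suc n) k else 0) * gterm (Suc m) k c e)"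
      by (simp add: Dm_gterm_Dp mult_ac)
    finally have 1: "lift Dm (lift Dp c) = \<dots>" .
    have "lift Br (lift Om c) = (\<lambda>e. \<Sum>k\<le>m. gcoef m (n - 1) k * gterm (Suc m) (Suc k) c e)"
      by (subst IH2) (simp add: lift_linear Br_gterm_Om)
    also have "\<dots> = (\<lambda>e. \<Sum>k\<le>Suc m. (if k = 0 then 0 else gcoef m (n - 1) (k - 1)) * gterm (Suc m) k c e)"
      by (subst sum.atMost_Suc_shift) simp
    finally have 2: "lift Br (lift Om c) = \<dots>" .
    have nz: "qround q (Suc m) * qround q (Suc n) \<noteq> 0" by (simp add: qround_neq_0)
    show ?case
    proof
      fix e
      have "qround q (Suc m) * qround q (Suc n) * c e = lift Dm (lift Dp c) e + lift Br (lift Om c) e"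
        using Suc.prems by (cases "c e = 0") (auto simp: lift_Br_Om bihom_def)
      also have "\<dots> = (\<Sum>k\<le>Suc m. ((if k \<le> m then q ^ (2 * k) * gcoef m (Suc n) k else 0)
          + (if k = 0 then 0 else gcoef m (n - 1) (k - 1))) * gterm (Suc m) k c e)"
        unfolding 1 2 by (simp only: sum.distrib[symmetric] distrib_right)
      also have "\<dots> = (\<Sum>k\<le>Suc m. qround q (Suc m) * qround q (Suc n) * (gcoef (Suc m) n k * gterm (Suc m) k c e))"
      proof (rule sum.cong)
        fix k assume "k \<in> {..Suc m}"
        then show "((if k \<le> m then q ^ (2 * k) * gcoef m (Suc n) k else 0)
            + (if k = 0 then 0 else gcoef m (n - 1) (k - 1))) * gterm (Suc m) k c e
          = qround q (Suc m) * qround q (Suc n) * (gcoef (Suc m) n k * gterm (Suc m) k c e)"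
          using gcoef_rec[of k m n] zero[of k] by (cases "k \<le> n") (simp_all add: mult.assoc)
      qed simp
      finally have "qround q (Suc m) * qround q (Suc n) * c e
          = qround q (Suc m) * qround q (Suc n) * (\<Sum>k\<le>Suc m. gcoef (Suc m) n k * gterm (Suc m) k c e)"
        by (simp only: sum_distrib_left)
      then show "c e = (\<Sum>k\<le>Suc m. gcoef (Suc m) n k * gterm (Suc m) k c e)"
        using mult_left_cancel[OF nz] by blast
    qed
  qed
  also have "\<dots> = (\<lambda>e. \<Sum>k=0..min m n. gcoef m n k * gterm m k c e)"
  proof
    fix e
    have "gterm m k c e = 0" if "k \<le> m" "\<not> k \<le> min m n" for k
      using Om_pow_eq_0[OF assms, of k] that by (simp add: gterm_def linop_zero linop_funpow)
    then show "(\<Sum>k\<le>m. gcoef m n k * gterm m k c e) = (\<Sum>k=0..min m n. gcoef m n k * gterm m k c e)"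
      by (intro sum.mono_neutral_right) auto
  qed
  finally show ?thesis .
qed

section \<open>The operators on the algebra\<close>

text \<open>Only two weighted shifts survive: what \<open>Cop\<close> contributes to y_1 x_2 cancels
  against x_1 y_2 except for a weight free of the factor q^(2b).\<close>

lemma act_bracket: "act (bracket s 1 2) c = lift Br c"
proof
  fix e :: "nat \<Rightarrow> nat \<times> nat"
  obtain a b a' b' where e: "e (Suc 0) = (a, b)" "e 2 = (a', b')" by (metis surj_pair)
  have "act (bracket s 1 2) c e = inverse s * gact (X 1) (gact (Y 2) c) e - s * gact (Y 1) (gact (X 2) c) e"
    by (simp add: bracket_def w2_def act_minus act_smult del: gact.simps)
  also have "\<dots> = lift Br c e"
  proof -
    have two: "(2::nat) - 1 = Suc 0" "Suc (Suc 0) = (2::nat)" "(1::nat) - 1 = 0" by simp_all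
    have r: "(q ^ 2 - 1) * qround q m = q ^ (2 * m) - 1" for m by (rule qround_eq)
    have r': "q ^ x * (q ^ 2 - 1) * qround q m * y = q ^ x * (q ^ (2 * m) - 1) * y" for x m y
      unfolding r[symmetric] by (simp only: mult.assoc)
    show ?thesis
      by (cases a; cases b; cases a'; cases b')
        (simp_all add: two lift_def Br_def op_defs wshift_def e r' inverse_s, simp_all add: q0 s0 field_simps power_add power_mult power2_eq_square)
  qed
  finally show "act (bracket s 1 2) c e = lift Br c e" .
qed

lemma lift_delta:
  assumes "e 1 = (a, b)" "e 2 = (c, d)"
  shows "lift Dp (delta e) = (\<lambda>x. qround q a * q ^ b * M e (a - 1) b (Suc c) d x
        + q ^ (2 * a) * inverse (q ^ c) * qround q b * M e a (b - 1) c (Suc d) x)"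
    and "lift Dm (delta e) = (\<lambda>x. qround q c * q ^ (2 * d) * inverse (q ^ b) * M e (Suc a) b (c - 1) d x
        + qround q d * q ^ c * M e a (Suc b) c (d - 1) x)"
proof -
  \<comment> \<open>Says that \<open>x\<close> agrees with \<open>e\<close> outside blocks 1 and 2,
    which reduces the comparison of point masses to four exponents.\<close>
  define R where "R x \<longleftrightarrow> (\<forall>i. i \<noteq> 1 \<longrightarrow> i \<noteq> 2 \<longrightarrow> x i = e i)" for x
  have upd_eq: "x(1 := v, 2 := w) = y \<longleftrightarrow> (\<forall>i. i \<noteq> 1 \<longrightarrow> i \<noteq> 2 \<longrightarrow> x i = y i) \<and> v = y 1 \<and> w = y 2"
    (is "?l \<longleftrightarrow> ?r") for x y :: "nat \<Rightarrow> nat \<times> nat" and v w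
  proof
    assume ?l
    then show ?r by force
  next
    assume ?r
    then show ?l by (intro ext) (metis fun_upd_apply)
  qed
  have 1: "x(1 := v, 2 := w) = e \<longleftrightarrow> R x \<and> v = (a, b) \<and> w = (c, d)" for x v w
    unfolding upd_eq R_def assms ..
  have 2: "x = e(1 := v, 2 := w) \<longleftrightarrow> R x \<and> x 1 = v \<and> x 2 = w" for x v w
    unfolding R_def using upd_eq[of e v w x] by metis
  have "lift Dp (delta e) x = qround q a * q ^ b * M e (a - 1) b (Suc c) d x
        + q ^ (2 * a) * inverse (q ^ c) * qround q b * M e a (b - 1) c (Suc d) x" for x
  proof -
    obtain a1 b1 c1 d1 where x: "x 1 = (a1, b1)" "x 2 = (c1, d1)" by (metis surj_pair)
    show ?thesis
      unfolding lift_def Dp_def M_def delta_def 1 2 x fst_conv snd_conv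
      by (cases "R x"; cases a; cases b; cases c1; cases d1) auto
  qed
  then show "lift Dp (delta e) = (\<lambda>x. qround q a * q ^ b * M e (a - 1) b (Suc c) d x
        + q ^ (2 * a) * inverse (q ^ c) * qround q b * M e a (b - 1) c (Suc d) x)" by blast
  have "lift Dm (delta e) x = qround q c * q ^ (2 * d) * inverse (q ^ b) * M e (Suc a) b (c - 1) d x
        + qround q d * q ^ c * M e a (Suc b) c (d - 1) x" for x
  proof -
    obtain a1 b1 c1 d1 where x: "x 1 = (a1, b1)" "x 2 = (c1, d1)" by (metis surj_pair)
    show ?thesis
      unfolding lift_def Dm_def M_def delta_def 1 2 x fst_conv snd_conv
      by (cases "R x"; cases a1; cases b1; cases c; cases d) auto
  qed
  then show "lift Dm (delta e) = (\<lambda>x. qround q c * q ^ (2 * d) * inverse (q ^ b) * M e (Suc a) b (c - 1) d x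
        + qround q d * q ^ c * M e a (Suc b) c (d - 1) x)" by blast
qed

lemma NF_delta_pbw:
  assumes "e \<in> pbw_exps p" "p \<ge> 2"
  shows "NF (delta_word 1 2 (pbw_word p e)) = lift Dp (delta e)"
    "NF (delta_word 2 1 (pbw_word p e)) = lift Dm (delta e)"
proof -
  obtain a b c d where e: "e (Suc 0) = (a, b)" "e 2 = (c, d)" by (metis surj_pair)
  let ?w = "tail_word 3 p e"
  have "(\<lambda>i. if 3 \<le> i \<and> i \<le> p then e i else (0, 0)) = e(1 := (0, 0), 2 := (0, 0))"
  proof
    fix i :: nat
    have "i = 0 \<or> i = 1 \<or> i = 2 \<or> 3 \<le> i" by arith
    then show "(if 3 \<le> i \<and> i \<le> p then e i else (0, 0)) = (e(1 := (0, 0), 2 := (0, 0))) i"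
      using assms by (auto simp: pbw_exps_def)
  qed
  then have w: "wact ?w vac = M e 0 0 0 0"
    using wact_tail_word[of 3 p e] assms(2) by (simp add: M_def)
  have idx: "gen_idx z \<ge> 3" if "z \<in> set ?w" for z
    using that by (auto simp: tail_word_def)
  have three: "Suc 2 = 3" "Suc (Suc 0) = 2" by simp_all
  have pw: "pbw_word p e = replicate a (X (Suc 0)) @ replicate b (Y (Suc 0)) @ replicate c (X 2) @ replicate d (Y 2) @ ?w"
    using tail_word_rec[of "Suc 0" p e] tail_word_rec[of 2 p e] assms(2) e
    by (simp add: pbw_word_def tail_word_def three)
  show "NF (delta_word 1 2 (pbw_word p e)) = lift Dp (delta e)"
    unfolding NF_delta_word pw using dact_12[OF w, of a b c d] lift_delta(1)[of e a b c d] e idx by fastforce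
  show "NF (delta_word 2 1 (pbw_word p e)) = lift Dm (delta e)"
    unfolding NF_delta_word pw using dact_21[OF w, of a b c d] lift_delta(2)[of e a b c d] e idx by fastforce
qed

lemma NF_sum:
  assumes "finite A" "\<And>i. i \<in> A \<Longrightarrow> fin (g i)"
  shows "NF (fa_sum g A) = (\<lambda>e. \<Sum>i\<in>A. NF (g i) e)"
  using act_sum[OF assms] by (simp add: NF_def)

lemma NF_smult: "fin a \<Longrightarrow> NF (fa_smult k a) = (\<lambda>e. k * NF a e)"
  by (simp add: NF_def act_smult)

text \<open>On elements of fixed degree in the letters of index k the normalization 1/(n_k) is the
  same for all monomials, so the polarization is a scalar times a linear operator.\<close>

lemma polP_general:
  assumes h: "valid p h" and T: "linop T" and kl: "l \<in> {1..p}"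
    and deg: "\<And>e. NF h e \<noteq> 0 \<Longrightarrow> pbw_deg e k = m"
    and word: "\<And>e. e \<in> pbw_exps p \<Longrightarrow> NF (delta_word k l (pbw_word p e)) = T (delta e)"
  shows "valid p (polP q p k l h)" "NF (polP q p k l h) = (\<lambda>x. inverse (qround q m) * T (NF h) x)"
proof -
  let ?S = "{e. NF h e \<noteq> 0}"
  have S: "finite ?S" "\<And>e. e \<in> ?S \<Longrightarrow> e \<in> pbw_exps p" using NF_valid(1)[OF h] by (auto simp: fcoord_def)
  have pol: "polP q p k l h = fa_sum (\<lambda>e. fa_smult (NF h e / qround q (pbw_deg e k)) (delta_word k l (pbw_word p e))) ?S"
    by (simp add: polP_def pbw_coords_eq_NF[OF h] Let_def)
  have v: "valid p (delta_word k l (pbw_word p e))" for e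
    using valid_delta_word[OF words_in_pbw_word kl] .
  show "valid p (polP q p k l h)" unfolding pol by (intro valid_sum valid_smult v)
  have "NF h = (\<lambda>x. \<Sum>e\<in>?S. NF h e * delta e x)"
  proof
    fix x
    have "(\<Sum>e\<in>?S. NF h e * delta e x) = (\<Sum>e\<in>?S. if e = x then NF h e else 0)"
      by (rule sum.cong) (auto simp: delta_def)
    then show "NF h x = (\<Sum>e\<in>?S. NF h e * delta e x)" using S(1) by simp
  qed
  then have "T (NF h) = T (\<lambda>x. \<Sum>e\<in>?S. NF h e * delta e x)" by simp
  also have "\<dots> = (\<lambda>x. \<Sum>e\<in>?S. NF h e * T (delta e) x)"
    unfolding linop_sum[OF T] linop_smult[OF T] ..
  finally have T_NF: "T (NF h) = \<dots>" .
  have "NF (polP q p k l h) = (\<lambda>x. \<Sum>e\<in>?S. NF h e / qround q (pbw_deg e k) * NF (delta_word k l (pbw_word p e)) x)"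
    unfolding pol by (subst NF_sum) (use S valid_fin[OF v] in \<open>auto simp: NF_smult\<close>)
  also have "\<dots> = (\<lambda>x. inverse (qround q m) * T (NF h) x)"
    unfolding T_NF sum_distrib_left
    by (intro ext sum.cong) (use S word deg in \<open>auto simp: field_simps\<close>)
  finally show "NF (polP q p k l h) = (\<lambda>x. inverse (qround q m) * T (NF h) x)" .
qed


lemma polP_12:
  assumes "valid p h" "p \<ge> 2" "bihom m n (NF h)"
  shows "valid p (polP q p 1 2 h)" "NF (polP q p 1 2 h) = (\<lambda>x. inverse (qround q m) * lift Dp (NF h) x)"
  using polP_general[OF assms(1) linop_lift(1), of 2 1 m] assms NF_delta_pbw[of _ p] by (auto simp: bihom_def)

lemma polP_21:
  assumes "valid p h" "p \<ge> 2" "bihom m n (NF h)"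
  shows "valid p (polP q p 2 1 h)" "NF (polP q p 2 1 h) = (\<lambda>x. inverse (qround q n) * lift Dm (NF h) x)"
  using polP_general[OF assms(1) linop_lift(2), of 1 2 n] assms NF_delta_pbw[of _ p] by (auto simp: bihom_def)

lemma rfact_step: "j < m \<Longrightarrow> rfact (m - j) = qround q (m - j) * rfact (m - Suc j)"
  by (metis Suc_diff_Suc rfact_Suc)

text \<open>The normalizations (m), (m-1), ... multiply up to a quotient of factorials;
  \<open>j \<le> m\<close> keeps each of them nonzero.\<close>

lemma polP_12_pow:
  assumes "valid p h" "p \<ge> 2" "bihom m n (NF h)" "j \<le> m"
  shows "valid p ((polP q p 1 2 ^^ j) h) \<and> bihom (m - j) (n + j) (NF ((polP q p 1 2 ^^ j) h))
    \<and> NF ((polP q p 1 2 ^^ j) h) = (\<lambda>x. (rfact (m - j) / rfact m) * (lift Dp ^^ j) (NF h) x)"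
  using assms(4)
proof (induction j)
  case 0
  show ?case using assms by simp
next
  case (Suc j)
  let ?h = "(polP q p 1 2 ^^ j) h"
  have h: "valid p ?h" "bihom (m - j) (n + j) (NF ?h)"
    "NF ?h = (\<lambda>x. (rfact (m - j) / rfact m) * (lift Dp ^^ j) (NF h) x)"
    using Suc by auto
  note pol = polP_12[OF h(1) assms(2) h(2)]
  have "qround q (m - j) \<noteq> 0" using Suc.prems by (simp add: qround_neq_0)
  then have "NF (polP q p 1 2 ?h) = (\<lambda>x. (rfact (m - Suc j) / rfact m) * (lift Dp ^^ Suc j) (NF h) x)"
    unfolding pol(2) h(3) linop_smult[OF linop_lift(1)] using rfact_step[of j m] Suc.prems by (simp add: field_simps)
  moreover have "bihom (m - Suc j) (n + Suc j) (NF (polP q p 1 2 ?h))"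
    unfolding pol(2) using bihom_smult[OF bihom_Dp[OF h(2)]] by simp
  ultimately show ?case using pol(1) by simp
qed

lemma polP_21_pow:
  assumes "valid p h" "p \<ge> 2" "bihom m n (NF h)" "j \<le> n"
  shows "valid p ((polP q p 2 1 ^^ j) h) \<and> bihom (m + j) (n - j) (NF ((polP q p 2 1 ^^ j) h))
    \<and> NF ((polP q p 2 1 ^^ j) h) = (\<lambda>x. (rfact (n - j) / rfact n) * (lift Dm ^^ j) (NF h) x)"
  using assms(4)
proof (induction j)
  case 0
  show ?case using assms by simp
next
  case (Suc j)
  let ?h = "(polP q p 2 1 ^^ j) h"
  have h: "valid p ?h" "bihom (m + j) (n - j) (NF ?h)"
    "NF ?h = (\<lambda>x. (rfact (n - j) / rfact n) * (lift Dm ^^ j) (NF h) x)"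
    using Suc by auto
  note pol = polP_21[OF h(1) assms(2) h(2)]
  have "qround q (n - j) \<noteq> 0" using Suc.prems by (simp add: qround_neq_0)
  then have "NF (polP q p 2 1 ?h) = (\<lambda>x. (rfact (n - Suc j) / rfact n) * (lift Dm ^^ Suc j) (NF h) x)"
    unfolding pol(2) h(3) linop_smult[OF linop_lift(2)] using rfact_step[of j n] Suc.prems by (simp add: field_simps)
  moreover have "bihom (m + Suc j) (n - Suc j) (NF (polP q p 2 1 ?h))"
    unfolding pol(2) using bihom_smult[OF bihom_Dm[OF h(2)]] by simp
  ultimately show ?case using pol(1) by simp
qed

text \<open>Evaluate at the monomial with one more x_1 and y_2: the first term of \<open>Br\<close>
  is a nonzero multiple of \<open>c e\<close>, and the second involves a smaller y_1-exponent,
  covered by induction.\<close>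

lemma lift_Br_eq_0:
  assumes "lift Br c = (\<lambda>e. 0)"
  shows "c e = 0"
proof (induction "snd (e 1)" arbitrary: e rule: less_induct)
  case less
  obtain a b a' b' where e: "e 1 = (a, b)" "e 2 = (a', b')" by (metis surj_pair)
  let ?f = "e(1 := (Suc a, b), 2 := (a', Suc b'))"
  have upd: "?f(1 := (a, b), 2 := (a', b')) = e" using e by (auto simp: fun_eq_iff)
  have "c (e(1 := (Suc a, b - 1), 2 := (a' - 1, Suc b'))) = 0" if "b \<noteq> 0"
    by (rule less) (use that e in simp)
  then have "lift Br c ?f = inverse s * q ^ a * inverse (q ^ a') * c (?f(1 := (a, b), 2 := (a', b')))"
    unfolding lift_def Br_def by auto
  then show ?case using fun_cong[OF assms, of ?f] s0 q0 unfolding upd by simp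
qed

lemma lift_Br_inj:
  assumes "lift Br c = lift Br c'"
  shows "c = c'"
proof
  fix e
  have "lift Br (\<lambda>e. c e + (-1) * c' e) = (\<lambda>e. 0)"
    unfolding linop_add[OF linop_lift(3)] linop_smult[OF linop_lift(3)] using assms by simp
  then show "c e = c' e" using lift_Br_eq_0[of "\<lambda>e. c e + (-1) * c' e" e] by simp
qed

text \<open>Finite support makes the solution found in coordinates the image of an actual element,
  the witness for the \<open>SOME\<close> in \<open>omega12\<close>.\<close>

lemma fcoord_Om:
  assumes "fcoord p c" "p \<ge> 2"
  shows "fcoord p (lift Om c)"
proof -
  \<comment> \<open>\<open>?u\<close> and \<open>?v\<close> undo the two exponent raisings in
    \<open>Om\<close>.\<close>
  let ?u = "\<lambda>e :: nat \<Rightarrow> nat \<times> nat. e(1 := (fst (e 1) - 1, snd (e 1)), 2 := (fst (e 2), snd (e 2) - 1))"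
  let ?v = "\<lambda>e :: nat \<Rightarrow> nat \<times> nat. e(1 := (fst (e 1), snd (e 1) - 1), 2 := (fst (e 2) - 1, snd (e 2)))"
  let ?S = "{e. c e \<noteq> 0}"
  have S: "finite ?S" "?S \<subseteq> pbw_exps p" using assms(1) by (auto simp: fcoord_def)
  have "e \<in> ?u ` ?S \<union> ?v ` ?S" if nz: "lift Om c e \<noteq> 0" for e
  proof -
    let ?x = "e(1 := (Suc (fst (e 1)), snd (e 1)), 2 := (fst (e 2), Suc (snd (e 2))))"
    let ?y = "e(1 := (fst (e 1), Suc (snd (e 1))), 2 := (Suc (fst (e 2)), snd (e 2)))"
    have xy: "e = ?u ?x" "e = ?v ?y" by (auto simp: fun_eq_iff)
    have "c ?x \<noteq> 0 \<or> c ?y \<noteq> 0"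
    proof (rule ccontr)
      assume "\<not> ?thesis"
      then have "lift Om c e = 0" by (simp add: lift_def Om_def)
      then show False using nz by simp
    qed
    then show ?thesis
    proof
      assume "c ?x \<noteq> 0"
      then have "?u ?x \<in> ?u ` ?S" by blast
      then show ?thesis using xy(1) by simp
    next
      assume "c ?y \<noteq> 0"
      then have "?v ?y \<in> ?v ` ?S" by blast
      then show ?thesis using xy(2) by simp
    qed
  qed
  then have sub: "{e. lift Om c e \<noteq> 0} \<subseteq> ?u ` ?S \<union> ?v ` ?S" by blast
  moreover have "?u e \<in> pbw_exps p" "?v e \<in> pbw_exps p" if "e \<in> pbw_exps p" for e
    using that assms(2) by (auto simp: pbw_exps_def)
  ultimately show ?thesis
    using S finite_subset[OF sub] unfolding fcoord_def by blast
qed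

lemma valid_bracket: "p \<ge> 2 \<Longrightarrow> valid p (bracket s 1 2)"
  unfolding bracket_def w2_def
  by (intro valid_minus valid_smult valid_word) (auto simp: words_in_def)

lemma qint_eq: "qint q m = qround q m * q / q ^ m"
proof -
  have 1: "q - inverse q = (q ^ 2 - 1) / q" using q0 by (simp add: field_simps power2_eq_square)
  have 2: "q ^ m - inverse (q ^ m) = (q ^ (2 * m) - 1) / q ^ m"
    using q0 by (simp add: field_simps power_mult power2_eq_square power_mult_distrib)
  show ?thesis unfolding qint_def qround_def 1 2 using q0 q2_neq_1 by (simp add: field_simps)
qed

text \<open>Dividing the Capelli identity by its scalar gives a decomposition; injectivity of
  \<open>lift Br\<close> forces the coordinates of whatever element \<open>SOME\<close>
  picks.\<close>

lemma omega12_NF: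
  assumes h: "valid p h" and p: "p \<ge> 2" and bi: "bihom (Suc m) (Suc n) (NF h)"
  shows "valid p (omega12 q s p h)"
    "NF (omega12 q s p h) = (\<lambda>x. inverse (q * qround q (Suc n) * qround q (Suc m)) * lift Om (NF h) x)"
proof -
  define K where "K = qround q (Suc m) * qround q (Suc (Suc n))"
  have K: "K \<noteq> 0" by (simp add: K_def qround_neq_0)
  let ?g = "NF h"
  let ?PP = "polP q p 2 1 (polP q p 1 2 h)"
  note p12 = polP_12[OF h p bi]
  have bi12: "bihom m (Suc (Suc n)) (NF (polP q p 1 2 h))"
    unfolding p12(2) using bihom_smult[OF bihom_Dp[OF bi]] by simp
  note p21 = polP_21[OF p12(1) p bi12]
  have PP: "NF ?PP = (\<lambda>x. inverse K * lift Dm (lift Dp ?g) x)"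
    unfolding p21(2) p12(2) K_def linop_smult[OF linop_lift(2)] by (simp add: mult_ac)
  define w where "w = (\<lambda>x. inverse K * lift Om ?g x)"
  have BrOm: "lift Br (lift Om ?g) x = K * ?g x - lift Dm (lift Dp ?g) x" for x
    using bi unfolding lift_Br_Om K_def bihom_def by (cases "?g x = 0") auto
  have decomp: "?g x = NF ?PP x + lift Br w x" for x
    unfolding PP w_def linop_smult[OF linop_lift(3)] BrOm using K by (simp add: field_simps)
  have NF_rhs: "NF (fa_add ?PP (fa_mul (bracket s 1 2) b)) = (\<lambda>x. NF ?PP x + lift Br (NF b) x)"
    and valid_rhs: "valid p (fa_add ?PP (fa_mul (bracket s 1 2) b))" if "valid p b" for b
    using that valid_bracket[OF p] p21(1) valid_fin
    by (auto simp: NF_def act_add act_mul act_bracket[simplified] fin_mul intro!: valid_add valid_mul)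
  define Q where "Q b \<longleftrightarrow> valid p b \<and> eqH q p h (fa_add ?PP (fa_mul (bracket s 1 2) b))" for b
  have w: "fcoord p w"
    unfolding w_def using pbw_sum_smult(1) fcoord_Om[OF NF_valid(1)[OF h] p] by blast
  have "Q (pbw_sum p w)"
    unfolding Q_def using eqH_iff_NF[OF h valid_rhs] NF_rhs valid_pbw_sum NF_pbw_sum[OF w] decomp by auto
  then have "Q (SOME b. Q b)" by (rule someI[of Q])
  then obtain b where b: "b = (SOME b. Q b)" "Q b" by blast
  have "NF b = w"
  proof (rule lift_Br_inj)
    have "?g = (\<lambda>x. NF ?PP x + lift Br (NF b) x)"
      using b(2) eqH_iff_NF[OF h valid_rhs] NF_rhs unfolding Q_def by auto
    then have "NF ?PP x + lift Br (NF b) x = NF ?PP x + lift Br w x" for x using decomp by metis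
    then show "lift Br (NF b) = lift Br w" by (simp add: fun_eq_iff)
  qed
  define n' where "n' = (SOME n. \<forall>e. NF h e \<noteq> 0 \<longrightarrow> pbw_deg e 2 = n)"
  have om: "omega12 q s p h = fa_smult (qint q (n' + 1) / qint q n') b"
    unfolding omega12_def Let_def pbw_coords_eq_NF[OF h] n'_def b(1) Q_def by simp
  have vb: "valid p b" using b(2) by (simp add: Q_def)
  show "valid p (omega12 q s p h)" unfolding om by (intro valid_smult vb)
  have NF_om: "NF (omega12 q s p h) = (\<lambda>x. qint q (n' + 1) / qint q n' * w x)"
    unfolding om NF_smult[OF valid_fin[OF vb]] \<open>NF b = w\<close> ..
  show "NF (omega12 q s p h) = (\<lambda>x. inverse (q * qround q (Suc n) * qround q (Suc m)) * lift Om (NF h) x)"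
  \<comment> \<open>For zero coordinates the chosen degree \<open>n'\<close> is arbitrary, but both
    sides vanish.\<close>
  proof (cases "?g = (\<lambda>x. 0)")
    case True
    then show ?thesis unfolding NF_om w_def by (simp add: lift_linear)
  next
    case False
    then obtain e where "?g e \<noteq> 0" by auto
    then have "n' = Suc n" unfolding n'_def
      by (intro some_equality) (use bi in \<open>auto simp: bihom_def\<close>)
    moreover have "qround q (Suc n) \<noteq> 0" "qround q (Suc m) \<noteq> 0" "qround q (Suc (Suc n)) \<noteq> 0"
      by (simp_all add: qround_neq_0)
    \<comment> \<open>The prefactor [n+2]/[n+1] equals (n+2)/(q (n+1)), so its numerator cancels one
      factor of \<open>K\<close>.\<close>
    ultimately show ?thesis unfolding NF_om w_def K_def qint_eq using q0 by (simp add: field_simps)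
  qed
qed

lemma omega12_pow:
  assumes "valid p h" "p \<ge> 2" "bihom m n (NF h)" "k \<le> m" "k \<le> n"
  shows "valid p ((omega12 q s p ^^ k) h) \<and> bihom (m - k) (n - k) (NF ((omega12 q s p ^^ k) h))
    \<and> NF ((omega12 q s p ^^ k) h)
      = (\<lambda>x. (rfact (n - k) * rfact (m - k) / (q ^ k * rfact n * rfact m)) * (lift Om ^^ k) (NF h) x)"
  using assms(4,5)
proof (induction k)
  case 0
  show ?case using assms by simp
next
  case (Suc k)
  let ?h = "(omega12 q s p ^^ k) h"
  have h: "valid p ?h" "bihom (m - k) (n - k) (NF ?h)"
    "NF ?h = (\<lambda>x. (rfact (n - k) * rfact (m - k) / (q ^ k * rfact n * rfact m)) * (lift Om ^^ k) (NF h) x)"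
    using Suc by auto
  have idx: "Suc (m - Suc k) = m - k" "Suc (n - Suc k) = n - k" using Suc.prems by simp_all
  note om = omega12_NF[OF h(1) assms(2), of "m - Suc k" "n - Suc k", unfolded idx, OF h(2)]
  have "qround q (m - k) \<noteq> 0" "qround q (n - k) \<noteq> 0" using Suc.prems by (simp_all add: qround_neq_0)
  then have "NF (omega12 q s p ?h)
      = (\<lambda>x. (rfact (n - Suc k) * rfact (m - Suc k) / (q ^ Suc k * rfact n * rfact m)) * (lift Om ^^ Suc k) (NF h) x)"
    unfolding om(2) h(3) linop_smult[OF linop_lift(4)]
    using rfact_step[of k m] rfact_step[of k n] Suc.prems q0 by (simp add: field_simps)
  moreover have "bihom (m - Suc k) (n - Suc k) (NF (omega12 q s p ?h))"
    unfolding om(2) using bihom_smult[OF bihom_Om[OF h(2)]] by simp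
  ultimately show ?case using om(1) by simp
qed

lemma fa_pow_act:
  assumes "valid p b"
  shows "valid p (fa_pow b k) \<and> act (fa_pow b k) c = (act b ^^ k) c"
proof (induction k)
  case 0
  show ?case by (simp add: fa_pow_def valid_word words_in_def)
next
  case (Suc k)
  have "fa_pow b (Suc k) = fa_mul b (fa_pow b k)" by (simp add: fa_pow_def)
  then show ?case using Suc assms by (simp add: valid_mul act_mul valid_fin[of p])
qed

lemma qbinom_eq: "qbinom q (k + i) k = rfact (k + i) / (rfact i * rfact k * q ^ (k * i))"
proof -
  \<comment> \<open>The power of q relating [m]! to (m)!, from [i] = (i) q / q^i.\<close>
  define t where "t m = (\<Prod>i=1..m. q / q ^ i)" for m
  have t0: "t m \<noteq> 0" for m using q0 by (auto simp: t_def)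
  have f: "qfact q m = rfact m * t m" for m
    by (simp add: qfact_def rfact_def t_def qint_eq prod.distrib[symmetric])
  have t: "t (k + i) * q ^ (k * i) = t k * t i"
  proof (induction i)
    case 0
    then show ?case by (simp add: t_def)
  next
    case (Suc i)
    have S: "t (Suc m) = t m * (q / q ^ Suc m)" for m by (simp add: t_def)
    have "t (k + Suc i) * q ^ (k * Suc i) = (t (k + i) * q ^ (k * i)) * (q / q ^ Suc (k + i) * q ^ k)"
      by (simp add: S power_add)
    also have "q / q ^ Suc (k + i) * q ^ k = q / q ^ Suc i"
      using q0 by (simp add: power_add field_simps)
    finally show ?case by (simp add: Suc S)
  qed
  have "qbinom q (k + i) k = rfact (k + i) * t (k + i) / (rfact i * rfact k * (t k * t i))"
    by (simp add: qbinom_def f mult_ac)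
  also have "\<dots> = rfact (k + i) / (rfact i * rfact k * q ^ (k * i))"
    unfolding t[symmetric] using t0 by simp
  finally show ?thesis .
qed

lemma coefficient_eq:
  assumes "k \<le> m" "k \<le> n"
  shows "qbinom q m k * qbinom q n k / qbinom q (m + n - k + 1) k
      * ((rfact (n - k) / rfact (n - k + (m - k))) * ((rfact 0 / rfact (m - k))
        * (rfact (n - k) * rfact (m - k) / (q ^ k * rfact n * rfact m)))) = gcoef m n k"
proof -
  obtain i j where ij: "m = k + i" "n = k + j" using assms by (metis le_Suc_ex)
  have "k + i + j + 1 = k + Suc (i + j)" "k + i - k = i" "k + j - k = j"
    "k + i + (k + j) - 2 * k = i + j" "k + i + (k + j) - k = k + i + j" "j + i = i + j" by simp_all
  note idx = this
  \<comment> \<open>The three q-binomials together leave the factor q^k, which cancels the q^k in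
    the denominator coming from the k-fold \<open>\<Omega>\<close>-process.\<close>
  have "q ^ (k * Suc (i + j)) = q ^ (k * i) * q ^ (k * j) * q ^ k"
    by (simp add: power_add[symmetric] algebra_simps)
  moreover have "rfact (Suc (i + j)) = qround q (Suc (i + j)) * rfact (i + j)" by (rule rfact_Suc)
  moreover have "qround q (Suc (i + j)) \<noteq> 0" by (simp add: qround_neq_0)
  ultimately show ?thesis
    unfolding gcoef_def ij idx qbinom_eq rfact_0 using q0 by (simp add: field_simps)
qed

lemma expansion:
  assumes f: "valid p f" and p: "p \<ge> 2" and bi: "bihom m n (NF f)"
  shows "eqH q p f (fa_sum (\<lambda>k. fa_smult (qbinom q m k * qbinom q n k / qbinom q (m + n - k + 1) k)
        (fa_mul (fa_pow (bracket s 1 2) k)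
          ((polP q p 2 1 ^^ (m - k)) ((polP q p 1 2 ^^ (m - k)) ((omega12 q s p ^^ k) f)))))
      {0..min m n})"
proof -
  let ?c = "\<lambda>k. qbinom q m k * qbinom q n k / qbinom q (m + n - k + 1) k"
  let ?h = "\<lambda>k. (polP q p 2 1 ^^ (m - k)) ((polP q p 1 2 ^^ (m - k)) ((omega12 q s p ^^ k) f))"
  let ?t = "\<lambda>k. fa_mul (fa_pow (bracket s 1 2) k) (?h k)"
  have t: "valid p (?t k) \<and> (\<lambda>x. ?c k * NF (?t k) x) = (\<lambda>x. gcoef m n k * gterm m k (NF f) x)"
    if "k \<in> {0..min m n}" for k
  proof -
    have k: "k \<le> m" "k \<le> n" using that by simp_all
    let ?o = "(omega12 q s p ^^ k) f"
    let ?a = "(polP q p 1 2 ^^ (m - k)) ?o"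
    note o = omega12_pow[OF f p bi k]
    \<comment> \<open>The k-fold \<open>\<Omega>\<close>-process leaves bidegree (m-k, n-k); m - k
      polarizations exhaust index 1, the same number back restore it, and (12)^k returns to (m,
      n).\<close>
    have a: "valid p ?a" "bihom 0 (n - k + (m - k)) (NF ?a)"
      "NF ?a = (\<lambda>x. (rfact 0 / rfact (m - k)) * (lift Dp ^^ (m - k)) (NF ?o) x)"
      using polP_12_pow[of p ?o "m - k" "n - k" "m - k"] o p by auto
    have h: "valid p (?h k)"
      "NF (?h k) = (\<lambda>x. (rfact (n - k) / rfact (n - k + (m - k))) * (lift Dm ^^ (m - k)) (NF ?a) x)"
      using polP_21_pow[OF a(1) p a(2), of "m - k"] by auto
    note B = fa_pow_act[OF valid_bracket[OF p], of k]
    have "NF (?t k) = (lift Br ^^ k) (NF (?h k))"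
    proof -
      have "act (bracket s 1 2) = lift Br" by (rule ext) (rule act_bracket)
      then show ?thesis using B h(1) by (simp add: NF_def act_mul valid_fin[of p])
    qed
    also have "\<dots> = (\<lambda>x. (rfact (n - k) / rfact (n - k + (m - k))) * ((rfact 0 / rfact (m - k))
        * (rfact (n - k) * rfact (m - k) / (q ^ k * rfact n * rfact m))) * gterm m k (NF f) x)"
      unfolding h(2) a(3) gterm_def
      by (simp only: o[THEN conjunct2, THEN conjunct2] linop_smult[OF linop_funpow[OF linop_lift(1)]] linop_smult[OF linop_funpow[OF linop_lift(2)]]
          linop_smult[OF linop_funpow[OF linop_lift(3)]] mult.assoc)
    finally show ?thesis
      using B h(1) by (simp only: valid_mul coefficient_eq[OF k, symmetric] mult.assoc simp_thms)
  qed
  have v: "valid p (fa_sum (\<lambda>k. fa_smult (?c k) (?t k)) {0..min m n})"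
    by (intro valid_sum valid_smult) (use t in blast)
  have "NF (fa_sum (\<lambda>k. fa_smult (?c k) (?t k)) {0..min m n}) = (\<lambda>x. \<Sum>k\<in>{0..min m n}. ?c k * NF (?t k) x)"
    by (subst NF_sum) (use t[THEN conjunct1, THEN valid_fin] in \<open>auto simp: NF_smult\<close>)
  also have "\<dots> = (\<lambda>x. \<Sum>k\<in>{0..min m n}. gcoef m n k * gterm m k (NF f) x)"
    by (intro ext sum.cong) (use t in \<open>auto dest!: fun_cong\<close>)
  also have "\<dots> = NF f" using gordan_capelli[OF bi] by simp
  finally show ?thesis using eqH_iff_NF[OF f v] by simp
qed

end

theorem theorem3p8:
  fixes q s :: complex and p :: nat and n :: "nat \<Rightarrow> nat" and f :: fa
  assumes "cmod q = 1" and "q \<noteq> 1" and "q \<noteq> -1" and "q \<noteq> \<i>" and "q \<noteq> -\<i>"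
    and "s ^ 2 = q"
    and "\<forall>d::nat. d \<ge> 1 \<longrightarrow> q ^ (2 * d) \<noteq> 1"
    and "p \<ge> 2"
    and "valid p f"
    and "invariant q s p f"
    and "\<forall>e. pbw_coords q p f e \<noteq> 0 \<longrightarrow> (\<forall>i\<in>{1..p}. pbw_deg e i = n i)"
  shows "eqH q p f
    (fa_sum (\<lambda>k. fa_smult (qbinom q (n 1) k * qbinom q (n 2) k / qbinom q (n 1 + n 2 - k + 1) k)
        (fa_mul (fa_pow (bracket s 1 2) k)
          ((polP q p 2 1 ^^ (n 1 - k)) ((polP q p 1 2 ^^ (n 1 - k)) ((omega12 q s p ^^ k) f)))))
      {0..min (n 1) (n 2)})"
proof -
  interpret qplane q s
    using assms(1,6,7) by unfold_locales auto
  have "bihom (n 1) (n 2) (NF f)"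
    using assms(8,11) by (simp add: bihom_def pbw_coords_eq_NF[OF assms(9)])
  then show ?thesis by (rule expansion[OF assms(9,8)])
qed

end
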